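(* Let $H$ be a separable real Hilbert space with a complete orthonormal system $(e_k)_{k\ge 0}$, and let $0<\alpha<1$. Let $(\chi_n)_{n\ge0}$ be the Haar functions and $(\phi_n)_{n\ge0}$ the Schauder functions on $[0,1]$. Set $c_0(\alpha):=1$ and, for $n=2^k+l$ with $k\ge0$ and $0\le l\le 2^k-1$, $c_n(\alpha):=2^{k(\alpha-1/2)+\alpha-1}$. Define $$T_\alpha^H: C_\alpha^0([0,1];H)\to\mathcal C_0^H,\qquad F\mapsto\Big(c_n(\alpha)\int_{[0,1]}\chi_n\,dF\Big)_{n\ge0}.$$ Then $T_\alpha^H$ (is well defined and) is continuous and bijective, its operator norm is $1$, and its inverse is given by $$(T_\alpha^H)^{-1}:\mathcal C_0^H\to C_\alpha^0([0,1];H),\qquad(\eta_n)_{n\ge0}\mapsto\sum_{n=0}^\infty\frac{\eta_n}{c_n(\alpha)}\phi_n .$$ The operator norm of $(T_\alpha^H)^{-1}$ satisfies $$\lVert(T_\alpha^H)^{-1}\rVert\le\frac{2}{(2^\alpha-1)(2^{1-\alpha}-1)}.$$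
   Context: Haar functions: $\chi_0\equiv1$, and for $k\ge0$, $0\le l\le2^k-1$, $\chi_{2^k+l}(t)=\sqrt{2^k}$ for $\frac{2l}{2^{k+1}}\le t<\frac{2l+1}{2^{k+1}}$, $=-\sqrt{2^k}$ for $\frac{2l+1}{2^{k+1}}\le t\le\frac{2l+2}{2^{k+1}}$, and $=0$ otherwise. Schauder functions: $\phi_n(t)=\int_0^t\chi_n(s)\,ds$, $t\in[0,1]$. For a function $F$ on $[0,1]$ with values in $\mathbb R$ or $H$, the integral against a Haar function is defined by $\int_{[0,1]}\chi_0\,dF=F(1)-F(0)$ and, for $n=2^k+l$ with $0\le l\le2^k-1$, $\int_{[0,1]}\chi_n\,dF=\sqrt{2^k}\,\big[2F(\tfrac{2l+1}{2^{k+1}})-F(\tfrac{2l+2}{2^{k+1}})-F(\tfrac{2l}{2^{k+1}})\big]$. $$C_\alpha^0([0,1];H)=\Big\{F:[0,1]\to H:\ F(0)=0,\ \lim_{\delta\to0}\sup_{t\ne s,\,|t-s|<\delta}\frac{\lVert F(t)-F(s)\rVert_H}{|t-s|^\alpha}=0\Big\},$$ normed by $\lVert F\rVert_\alpha=\sup_{0\le s<t\le1}\lVert F(t)-F(s)\rVert_H/|t-s|^\alpha$. $\mathcal C_0^H$ is the Banach space of $H$-valued sequences $(\eta_n)_{n\ge0}$ with $\lim_{n\to\infty}\lVert\eta_n\rVert_H=0$, with norm $\lVert(\eta_n)\rVert_\infty=\sup_n\lVert\eta_n\rVert_H$. *)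

theory Defs
  imports "HOL-Analysis.Analysis" "HOL-Library.Discrete_Functions"
begin

definition complete_orthonormal_system :: "(nat \<Rightarrow> 'h::real_inner) \<Rightarrow> bool" where
  "complete_orthonormal_system e \<longleftrightarrow>
     (\<forall>j k. inner (e j) (e k) = (if j = k then 1 else 0)) \<and> closure (span (range e)) = UNIV"

text \<open>Every \<open>n \<ge> 1\<close> is uniquely \<open>2 ^ k + l\<close> with \<open>l < 2 ^ k\<close>; then \<open>k = dyadic_level n\<close> and
  \<open>l = dyadic_pos n\<close>.\<close>

definition dyadic_level :: "nat \<Rightarrow> nat" where
  "dyadic_level n = floor_log n"

definition dyadic_pos :: "nat \<Rightarrow> nat" where
  "dyadic_pos n = n - 2 ^ floor_log n"

lemma dyadic_level_eq: "l < 2 ^ k \<Longrightarrow> dyadic_level (2 ^ k + l) = k"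
  unfolding dyadic_level_def by (rule floor_log_eqI) auto

lemma dyadic_pos_eq: "l < 2 ^ k \<Longrightarrow> dyadic_pos (2 ^ k + l) = l"
  using dyadic_level_eq[of l k] by (simp add: dyadic_pos_def dyadic_level_def)

lemma dyadic_decomp:
  assumes "n \<ge> 1"
  shows "n = 2 ^ dyadic_level n + dyadic_pos n" "dyadic_pos n < 2 ^ dyadic_level n"
  using floor_log_exp2_le[of n] floor_log_exp2_gt[of n] assms
  by (simp_all add: dyadic_level_def dyadic_pos_def)

text \<open>The functions \<open>haar n\<close> and \<open>schauder n\<close> are meant on \<open>{0..1}\<close> only.\<close>

definition haar :: "nat \<Rightarrow> real \<Rightarrow> real" where
  "haar n t =
     (if n = 0 then 1
      else let k = dyadic_level n; l = real (dyadic_pos n) in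
        if 2 * l / 2 ^ (k + 1) \<le> t \<and> t < (2 * l + 1) / 2 ^ (k + 1) then sqrt (2 ^ k)
        else if (2 * l + 1) / 2 ^ (k + 1) \<le> t \<and> t \<le> (2 * l + 2) / 2 ^ (k + 1) then - sqrt (2 ^ k)
        else 0)"

definition schauder :: "nat \<Rightarrow> real \<Rightarrow> real" where
  "schauder n t = integral {0..t} (haar n)"

text \<open>\<open>haar_integral n F\<close> is the integral of the \<open>n\<close>-th Haar function against \<open>dF\<close>.\<close>

definition haar_integral :: "nat \<Rightarrow> (real \<Rightarrow> 'h::real_vector) \<Rightarrow> 'h" where
  "haar_integral n F =
     (if n = 0 then F 1 - F 0
      else let k = dyadic_level n; l = real (dyadic_pos n) in
        sqrt (2 ^ k) *\<^sub>R
          (2 *\<^sub>R F ((2 * l + 1) / 2 ^ (k + 1)) - F ((2 * l + 2) / 2 ^ (k + 1)) - F (2 * l / 2 ^ (k + 1))))"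

definition haar_weight :: "real \<Rightarrow> nat \<Rightarrow> real" where
  "haar_weight \<alpha> n =
     (if n = 0 then 1 else 2 powr (real (dyadic_level n) * (\<alpha> - 1 / 2) + \<alpha> - 1))"

text \<open>A function on \<open>{0..1}\<close> is represented by its extension by \<open>0\<close> to the real line, so that
  equality of functions is equality on \<open>{0..1}\<close> and the vector space operations are pointwise.
  Suprema are taken in \<open>ennreal\<close> because they may be infinite (for large \<open>\<delta>\<close> not even the
  limit condition excludes this a priori, and \<open>Sup\<close> of an unbounded set of reals is unspecified).\<close>

definition holder0_space :: "real \<Rightarrow> (real \<Rightarrow> 'h::real_normed_vector) set" where
  "holder0_space \<alpha> =
     {F. (\<forall>t. t \<notin> {0..1} \<longrightarrow> F t = 0) \<and> F 0 = 0 \<and>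
         ((\<lambda>\<delta>. SUP (s, t) \<in> {(s, t). s \<in> {0..1} \<and> t \<in> {0..1} \<and> t \<noteq> s \<and> \<bar>t - s\<bar> < \<delta>}.
                 ennreal (norm (F t - F s) / \<bar>t - s\<bar> powr \<alpha>)) \<longlongrightarrow> 0) (at_right 0)}"

definition holder_norm :: "real \<Rightarrow> (real \<Rightarrow> 'h::real_normed_vector) \<Rightarrow> ennreal" where
  "holder_norm \<alpha> F =
     (SUP (s, t) \<in> {(s, t). 0 \<le> s \<and> s < t \<and> t \<le> 1}. ennreal (norm (F t - F s) / \<bar>t - s\<bar> powr \<alpha>))"

definition c0_space :: "(nat \<Rightarrow> 'h::real_normed_vector) set" where
  "c0_space = {\<eta>. (\<lambda>n. norm (\<eta> n)) \<longlonglongrightarrow> 0}"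

definition c0_norm :: "(nat \<Rightarrow> 'h::real_normed_vector) \<Rightarrow> ennreal" where
  "c0_norm \<eta> = (SUP n. ennreal (norm (\<eta> n)))"

text \<open>Both spaces as metric spaces, with the distance induced by the norm.\<close>

definition holder0_metric :: "real \<Rightarrow> (real \<Rightarrow> 'h::real_normed_vector) metric" where
  "holder0_metric \<alpha> = metric (holder0_space \<alpha>, \<lambda>F G. enn2real (holder_norm \<alpha> (\<lambda>t. F t - G t)))"

definition c0_metric :: "(nat \<Rightarrow> 'h::real_normed_vector) metric" where
  "c0_metric = metric (c0_space, \<lambda>\<eta> \<theta>. enn2real (c0_norm (\<lambda>n. \<eta> n - \<theta> n)))"

text \<open>Operator norm of a linear map \<open>T\<close> on the normed space \<open>(X, p)\<close> into a space with norm \<open>q\<close>.\<close>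

definition operator_norm ::
  "'a set \<Rightarrow> ('a \<Rightarrow> ennreal) \<Rightarrow> ('b \<Rightarrow> ennreal) \<Rightarrow> ('a \<Rightarrow> 'b) \<Rightarrow> ennreal" where
  "operator_norm X p q T = (SUP x \<in> {x \<in> X. p x \<noteq> 0}. q (T x) / p x)"

definition haar_transform :: "real \<Rightarrow> (real \<Rightarrow> 'h::real_vector) \<Rightarrow> nat \<Rightarrow> 'h" where
  "haar_transform \<alpha> F = (\<lambda>n. haar_weight \<alpha> n *\<^sub>R haar_integral n F)"

definition schauder_partial_sum ::
  "real \<Rightarrow> (nat \<Rightarrow> 'h::real_vector) \<Rightarrow> nat \<Rightarrow> real \<Rightarrow> 'h" where
  "schauder_partial_sum \<alpha> \<eta> N =
     (\<lambda>t. if t \<in> {0..1} then \<Sum>n<N. schauder n t *\<^sub>R (\<eta> n /\<^sub>R haar_weight \<alpha> n) else 0)"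

definition schauder_series ::
  "real \<Rightarrow> (nat \<Rightarrow> 'h::real_normed_vector) \<Rightarrow> real \<Rightarrow> 'h" where
  "schauder_series \<alpha> \<eta> =
     (\<lambda>t. if t \<in> {0..1} then \<Sum>n. schauder n t *\<^sub>R (\<eta> n /\<^sub>R haar_weight \<alpha> n) else 0)"


subsection \<open>The norms are finite on the spaces and induce metrics\<close>

lemma holder_norm_le_iff:
  "holder_norm \<alpha> F \<le> C \<longleftrightarrow>
     (\<forall>s t. 0 \<le> s \<and> s < t \<and> t \<le> 1 \<longrightarrow> ennreal (norm (F t - F s) / \<bar>t - s\<bar> powr \<alpha>) \<le> C)"
  by (auto simp: holder_norm_def SUP_le_iff)

lemma holder_quotient_le_norm:
  "0 \<le> s \<Longrightarrow> s < t \<Longrightarrow> t \<le> 1 \<Longrightarrow> ennreal (norm (F t - F s) / \<bar>t - s\<bar> powr \<alpha>) \<le> holder_norm \<alpha> F"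
  using holder_norm_le_iff[of \<alpha> F "holder_norm \<alpha> F"] by simp

lemma holder_norm_triangle:
  "holder_norm \<alpha> (\<lambda>t. F t + G t) \<le> holder_norm \<alpha> F + holder_norm \<alpha> G"
  unfolding holder_norm_le_iff
proof (intro allI impI)
  fix s t :: real
  assume st: "0 \<le> s \<and> s < t \<and> t \<le> 1"
  let ?p = "\<bar>t - s\<bar> powr \<alpha>"
  have "norm (F t + G t - (F s + G s)) \<le> norm (F t - F s) + norm (G t - G s)"
    using norm_triangle_ineq[of "F t - F s" "G t - G s"] by (simp add: algebra_simps)
  then have "norm (F t + G t - (F s + G s)) / ?p \<le> norm (F t - F s) / ?p + norm (G t - G s) / ?p"
    by (simp add: divide_right_mono flip: add_divide_distrib)
  then have "ennreal (norm (F t + G t - (F s + G s)) / ?p)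
      \<le> ennreal (norm (F t - F s) / ?p) + ennreal (norm (G t - G s) / ?p)"
    by (metis ennreal_leI ennreal_plus divide_nonneg_nonneg norm_ge_zero powr_ge_zero)
  also have "\<dots> \<le> holder_norm \<alpha> F + holder_norm \<alpha> G"
    using st by (intro add_mono holder_quotient_le_norm) auto
  finally show "ennreal (norm (F t + G t - (F s + G s)) / ?p) \<le> holder_norm \<alpha> F + holder_norm \<alpha> G" .
qed

lemma holder_norm_minus: "holder_norm \<alpha> (\<lambda>t. F t - G t) = holder_norm \<alpha> (\<lambda>t. G t - F t)"
proof -
  have "norm (F t - G t - (F s - G s)) = norm (G t - F t - (G s - F s))" for s t
    by (metis minus_diff_eq norm_minus_commute minus_diff_minus)
  then show ?thesis
    by (simp add: holder_norm_def)
qed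

lemma holder_norm_uminus: "holder_norm \<alpha> (\<lambda>t. - F t) = holder_norm \<alpha> F"
  using holder_norm_minus[of \<alpha> "\<lambda>_. 0" F] by simp

lemma holder0_space_small_increments:
  assumes "F \<in> holder0_space \<alpha>" "\<epsilon> > 0"
  obtains \<delta> where "\<delta> > 0"
    "\<And>s t. s \<in> {0..1} \<Longrightarrow> t \<in> {0..1} \<Longrightarrow> \<bar>t - s\<bar> < \<delta> \<Longrightarrow> norm (F t - F s) \<le> \<epsilon> * \<bar>t - s\<bar> powr \<alpha>"
proof -
  let ?I = "\<lambda>\<delta>. {(s, t). s \<in> {0..1} \<and> t \<in> {0..1} \<and> t \<noteq> s \<and> \<bar>t - s\<bar> < \<delta>}"
  let ?S = "\<lambda>\<delta>. SUP (s, t) \<in> ?I \<delta>. ennreal (norm (F t - F s) / \<bar>t - s\<bar> powr \<alpha>)"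
  have "(?S \<longlongrightarrow> 0) (at_right 0)"
    using assms by (simp add: holder0_space_def)
  then have "\<forall>\<^sub>F \<delta> in at_right 0. ?S \<delta> < ennreal \<epsilon>"
    using assms(2) by (intro order_tendstoD(2)) auto
  then obtain \<delta> where \<delta>: "\<delta> > 0" "?S \<delta> < ennreal \<epsilon>"
    using eventually_happens[OF eventually_conj[OF _ eventually_at_right_less]]
    by (metis (mono_tags, lifting) trivial_limit_at_right_real)
  have "norm (F t - F s) \<le> \<epsilon> * \<bar>t - s\<bar> powr \<alpha>"
    if "s \<in> {0..1}" "t \<in> {0..1}" "\<bar>t - s\<bar> < \<delta>" for s t
  proof (cases "s = t")
    case False
    have "ennreal (norm (F t - F s) / \<bar>t - s\<bar> powr \<alpha>) \<le> ?S \<delta>"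
      using that False by (intro SUP_upper2[where i = "(s, t)"]) auto
    then have "ennreal (norm (F t - F s) / \<bar>t - s\<bar> powr \<alpha>) \<le> ennreal \<epsilon>"
      using \<delta>(2) by simp
    then have "norm (F t - F s) / \<bar>t - s\<bar> powr \<alpha> \<le> \<epsilon>"
      using assms(2) by (simp add: ennreal_le_iff)
    then show ?thesis
      using False by (simp add: pos_divide_le_eq)
  qed simp
  then show ?thesis
    using \<delta>(1) that by blast
qed

lemma holder0_space_continuous_on:
  assumes "F \<in> holder0_space \<alpha>" "0 < \<alpha>"
  shows "continuous_on {0..1} F"
proof -
  obtain \<delta> where \<delta>: "\<delta> > 0"
    "\<And>s t. s \<in> {0..1} \<Longrightarrow> t \<in> {0..1} \<Longrightarrow> \<bar>t - s\<bar> < \<delta> \<Longrightarrow> norm (F t - F s) \<le> 1 * \<bar>t - s\<bar> powr \<alpha>"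
    using holder0_space_small_increments[OF assms(1) zero_less_one] by blast
  show ?thesis
    unfolding continuous_on_iff
  proof (intro ballI allI impI)
    fix s \<epsilon> :: real assume s: "s \<in> {0..1}" "0 < \<epsilon>"
    show "\<exists>d>0. \<forall>t\<in>{0..1}. dist t s < d \<longrightarrow> dist (F t) (F s) < \<epsilon>"
    proof (intro exI[of _ "min \<delta> (\<epsilon> powr (1 / \<alpha>))"] conjI ballI impI)
      fix t :: real assume t: "t \<in> {0..1}" "dist t s < min \<delta> (\<epsilon> powr (1 / \<alpha>))"
      then have "norm (F t - F s) \<le> \<bar>t - s\<bar> powr \<alpha>"
        using \<delta>(2)[of s t] s by (simp add: dist_real_def)
      also have "\<dots> < (\<epsilon> powr (1 / \<alpha>)) powr \<alpha>"
        using t assms(2) by (intro powr_less_mono2) (auto simp: dist_real_def)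
      also have "\<dots> = \<epsilon>"
        using s assms(2) by (simp add: powr_powr)
      finally show "dist (F t) (F s) < \<epsilon>"
        by (simp add: dist_norm)
    qed (use s \<delta> in auto)
  qed
qed

lemma holder_norm_finite:
  assumes "F \<in> holder0_space \<alpha>" "0 < \<alpha>"
  shows "holder_norm \<alpha> F < top"
proof -
  obtain \<delta> where \<delta>: "\<delta> > 0"
    "\<And>s t. s \<in> {0..1} \<Longrightarrow> t \<in> {0..1} \<Longrightarrow> \<bar>t - s\<bar> < \<delta> \<Longrightarrow> norm (F t - F s) \<le> 1 * \<bar>t - s\<bar> powr \<alpha>"
    using holder0_space_small_increments[OF assms(1) zero_less_one] by blast
  have "bounded (F ` {0..1})"
    using holder0_space_continuous_on[OF assms] by (intro compact_imp_bounded compact_continuous_image) auto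
  then obtain B where B: "\<And>t. t \<in> {0..1} \<Longrightarrow> norm (F t) \<le> B"
    by (metis bounded_iff imageI)
  have B0: "0 \<le> B"
    using B[of 0] norm_ge_zero[of "F 0"] by (simp del: norm_ge_zero)
  have "norm (F t - F s) / \<bar>t - s\<bar> powr \<alpha> \<le> max 1 (2 * B / \<delta> powr \<alpha>)"
    if st: "0 \<le> s \<and> s < t \<and> t \<le> 1" for s t
  proof (cases "\<bar>t - s\<bar> < \<delta>")
    case True
    then have "norm (F t - F s) / \<bar>t - s\<bar> powr \<alpha> \<le> 1"
      using \<delta>(2)[of s t] st by (simp add: pos_divide_le_eq)
    then show ?thesis by simp
  next
    case False
    have "norm (F t - F s) \<le> 2 * B"
      using norm_triangle_ineq4[of "F t" "F s"] B[of t] B[of s] st by simp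
    moreover have "\<delta> powr \<alpha> \<le> \<bar>t - s\<bar> powr \<alpha>"
      using False \<delta>(1) assms(2) by (intro powr_mono2) auto
    ultimately have "norm (F t - F s) / \<bar>t - s\<bar> powr \<alpha> \<le> 2 * B / \<delta> powr \<alpha>"
      using \<delta>(1) B0 by (intro frac_le) auto
    then show ?thesis by simp
  qed
  then have "holder_norm \<alpha> F \<le> ennreal (max 1 (2 * B / \<delta> powr \<alpha>))"
    unfolding holder_norm_le_iff by (blast intro: ennreal_leI)
  also have "\<dots> < top" by simp
  finally show ?thesis .
qed

lemma holder_norm_diff_finite:
  assumes "F \<in> holder0_space \<alpha>" "G \<in> holder0_space \<alpha>" "0 < \<alpha>"
  shows "holder_norm \<alpha> (\<lambda>t. F t - G t) < top"
proof -
  have "holder_norm \<alpha> (\<lambda>t. F t + - G t) \<le> holder_norm \<alpha> F + holder_norm \<alpha> G"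
    using holder_norm_triangle[of \<alpha> F "\<lambda>t. - G t"] by (simp add: holder_norm_uminus)
  then show ?thesis
    using holder_norm_finite[OF assms(1,3)] holder_norm_finite[OF assms(2,3)]
    by (simp add: order_le_less_trans)
qed

lemma Metric_space_holder0:
  assumes "0 < \<alpha>"
  shows "Metric_space (holder0_space \<alpha> :: (real \<Rightarrow> 'h::real_normed_vector) set)
           (\<lambda>F G. enn2real (holder_norm \<alpha> (\<lambda>t. F t - G t)))"
proof
  fix F G :: "real \<Rightarrow> 'h"
  show "enn2real (holder_norm \<alpha> (\<lambda>t. F t - G t)) = enn2real (holder_norm \<alpha> (\<lambda>t. G t - F t))"
    by (simp add: holder_norm_minus[of \<alpha> F])
  assume FG: "F \<in> holder0_space \<alpha>" "G \<in> holder0_space \<alpha>"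
  show "enn2real (holder_norm \<alpha> (\<lambda>t. F t - G t)) = 0 \<longleftrightarrow> F = G"
  proof
    assume "enn2real (holder_norm \<alpha> (\<lambda>t. F t - G t)) = 0"
    then have *: "holder_norm \<alpha> (\<lambda>t. F t - G t) = 0"
      using holder_norm_diff_finite[OF FG assms] by (auto simp: enn2real_eq_0_iff)
    show "F = G"
    proof
      fix t
      show "F t = G t"
      proof (cases "0 < t \<and> t \<le> 1")
        case True
        then have "norm (F t - G t - (F 0 - G 0)) / \<bar>t - 0\<bar> powr \<alpha> \<le> 0"
          using holder_quotient_le_norm[of 0 t "\<lambda>t. F t - G t" \<alpha>] *
          by (simp add: ennreal_eq_0_iff)
        then show ?thesis
          using True FG by (auto simp: holder0_space_def divide_le_0_iff)
      next
        case False
        then show ?thesis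
          using FG by (cases "t = 0") (auto simp: holder0_space_def)
      qed
    qed
  next
    assume "F = G"
    then have "holder_norm \<alpha> (\<lambda>t. F t - G t) \<le> 0"
      unfolding holder_norm_le_iff by simp
    then show "enn2real (holder_norm \<alpha> (\<lambda>t. F t - G t)) = 0"
      by simp
  qed
next
  fix F G K :: "real \<Rightarrow> 'h"
  assume FGK: "F \<in> holder0_space \<alpha>" "G \<in> holder0_space \<alpha>" "K \<in> holder0_space \<alpha>"
  have "holder_norm \<alpha> (\<lambda>t. F t - K t)
      \<le> holder_norm \<alpha> (\<lambda>t. F t - G t) + holder_norm \<alpha> (\<lambda>t. G t - K t)"
    using holder_norm_triangle[of \<alpha> "\<lambda>t. F t - G t" "\<lambda>t. G t - K t"] by simp
  then show "enn2real (holder_norm \<alpha> (\<lambda>t. F t - K t))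
      \<le> enn2real (holder_norm \<alpha> (\<lambda>t. F t - G t)) + enn2real (holder_norm \<alpha> (\<lambda>t. G t - K t))"
    using holder_norm_diff_finite[OF FGK(1,2) assms] holder_norm_diff_finite[OF FGK(2,3) assms]
    by (metis enn2real_mono enn2real_plus ennreal_add_less_top)
qed simp

lemma c0_norm_finite:
  assumes "\<eta> \<in> c0_space"
  shows "c0_norm \<eta> < top"
proof -
  have "Bseq (\<lambda>n. norm (\<eta> n))"
    using assms by (intro convergent_imp_Bseq) (auto simp: c0_space_def convergent_def)
  then obtain B where "\<And>n. norm (\<eta> n) \<le> B"
    by (metis BseqE real_norm_def abs_norm_cancel)
  then have "c0_norm \<eta> \<le> ennreal B"
    unfolding c0_norm_def by (intro SUP_least ennreal_leI)
  then show ?thesis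
    by (simp add: order_le_less_trans)
qed

lemma c0_space_diff: "\<eta> \<in> c0_space \<Longrightarrow> \<theta> \<in> c0_space \<Longrightarrow> (\<lambda>n. \<eta> n - \<theta> n) \<in> c0_space"
  using tendsto_diff[of \<eta> 0 sequentially \<theta> 0] by (simp add: c0_space_def tendsto_norm_zero_iff)

lemma Metric_space_c0:
  "Metric_space (c0_space :: (nat \<Rightarrow> 'h::real_normed_vector) set)
     (\<lambda>\<eta> \<theta>. enn2real (c0_norm (\<lambda>n. \<eta> n - \<theta> n)))"
proof
  fix \<eta> \<theta> :: "nat \<Rightarrow> 'h"
  show "enn2real (c0_norm (\<lambda>n. \<eta> n - \<theta> n)) = enn2real (c0_norm (\<lambda>n. \<theta> n - \<eta> n))"
    by (simp add: c0_norm_def norm_minus_commute)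
  assume *: "\<eta> \<in> c0_space" "\<theta> \<in> c0_space"
  have "c0_norm (\<lambda>n. \<eta> n - \<theta> n) = 0 \<longleftrightarrow> \<eta> = \<theta>"
    by (auto simp: c0_norm_def fun_eq_iff SUP_eq_iff simp flip: bot_ennreal)
       (auto simp: bot_ennreal)
  then show "enn2real (c0_norm (\<lambda>n. \<eta> n - \<theta> n)) = 0 \<longleftrightarrow> \<eta> = \<theta>"
    using c0_norm_finite[OF c0_space_diff[OF *]] by (auto simp: enn2real_eq_0_iff)
next
  fix \<eta> \<theta> \<zeta> :: "nat \<Rightarrow> 'h"
  assume *: "\<eta> \<in> c0_space" "\<theta> \<in> c0_space" "\<zeta> \<in> c0_space"
  have "c0_norm (\<lambda>n. \<eta> n - \<zeta> n) \<le> c0_norm (\<lambda>n. \<eta> n - \<theta> n) + c0_norm (\<lambda>n. \<theta> n - \<zeta> n)"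
    unfolding c0_norm_def
  proof (rule SUP_least)
    fix n
    have "ennreal (norm (\<eta> n - \<zeta> n)) \<le> ennreal (norm (\<eta> n - \<theta> n)) + ennreal (norm (\<theta> n - \<zeta> n))"
      using norm_triangle_ineq[of "\<eta> n - \<theta> n" "\<theta> n - \<zeta> n"]
      by (simp add: ennreal_leI flip: ennreal_plus)
    also have "\<dots> \<le> (SUP n. ennreal (norm (\<eta> n - \<theta> n))) + (SUP n. ennreal (norm (\<theta> n - \<zeta> n)))"
      by (intro add_mono SUP_upper) auto
    finally show "ennreal (norm (\<eta> n - \<zeta> n))
      \<le> (SUP n. ennreal (norm (\<eta> n - \<theta> n))) + (SUP n. ennreal (norm (\<theta> n - \<zeta> n)))" .
  qed
  then show "enn2real (c0_norm (\<lambda>n. \<eta> n - \<zeta> n))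
      \<le> enn2real (c0_norm (\<lambda>n. \<eta> n - \<theta> n)) + enn2real (c0_norm (\<lambda>n. \<theta> n - \<zeta> n))"
    using c0_norm_finite[OF c0_space_diff[OF *(1,2)]] c0_norm_finite[OF c0_space_diff[OF *(2,3)]]
    by (metis enn2real_mono enn2real_plus ennreal_add_less_top)
qed simp

lemma holder0_metric_simps:
  assumes "0 < \<alpha>"
  shows "mspace (holder0_metric \<alpha>) = holder0_space \<alpha>"
    and "mdist (holder0_metric \<alpha>) F G = enn2real (holder_norm \<alpha> (\<lambda>t. F t - G t))"
  unfolding holder0_metric_def
  by (simp_all add: Metric_space.mspace_metric Metric_space.mdist_metric Metric_space_holder0 assms)

lemma c0_metric_simps:
  shows "mspace c0_metric = c0_space"
    and "mdist c0_metric \<eta> \<theta> = enn2real (c0_norm (\<lambda>n. \<eta> n - \<theta> n))"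
  unfolding c0_metric_def
  by (simp_all add: Metric_space.mspace_metric Metric_space.mdist_metric Metric_space_c0)

lemma haar_transform_add:
  "haar_transform \<alpha> (\<lambda>t. F t + G t) = (\<lambda>n. haar_transform \<alpha> F n + haar_transform \<alpha> G n)"
  by (simp add: haar_transform_def haar_integral_def Let_def algebra_simps fun_eq_iff)

lemma haar_transform_scaleR:
  "haar_transform \<alpha> (\<lambda>t. c *\<^sub>R F t) = (\<lambda>n. c *\<^sub>R haar_transform \<alpha> F n)"
  by (simp add: haar_transform_def haar_integral_def Let_def algebra_simps fun_eq_iff)

end

theory Submission
  imports Defs
begin

text \<open>After rescaling, the terms of the Schauder series on dyadic level \<open>k\<close> are \<open>2 powr (- \<alpha> j)\<close> times
  tents of slope \<open>2 ^ j\<close> with disjoint supports, where \<open>j = k + 1\<close>, so the absolute increments between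
  two points at distance \<open>h\<close> add up to at most \<open>2 powr (- \<alpha> j) * min 2 (2 ^ j * h)\<close> on that level.
  Splitting the sum over all levels where \<open>2 ^ j * h\<close> is between 1 and 2 leaves two geometric sums and
  yields exactly the stated constant times \<open>h powr \<alpha>\<close>. The same estimate for the tail of a null
  sequence gives convergence in the Hoelder norm. Biorthogonality of Haar integrals and Schauder
  functions gives surjectivity; injectivity holds because the Haar integrals determine a continuous
  function vanishing at 0 on the dyadic points.\<close>

subsection \<open>The Schauder functions are rescaled tents\<close>

text \<open>One profile for all levels: in the coordinate \<open>2 ^ (k + 1) * t\<close> the
  Schauder functions of level \<open>k\<close> are multiples of the translates of
  \<open>tent\<close> to the odd integers \<open>2 * l + 1\<close>, whose supports meet only in
  endpoints.\<close>

definition tent :: "real \<Rightarrow> real" where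
  "tent x = max 0 (1 - \<bar>x\<bar>)"

lemma tent_nonneg: "0 \<le> tent x"
  by (simp add: tent_def)

lemma continuous_on_tent [continuous_intros]:
  "continuous_on S f \<Longrightarrow> continuous_on S (\<lambda>x. tent (f x))"
  unfolding tent_def by (intro continuous_intros)

lemma tent_has_real_derivative:
  assumes "x \<notin> {- 1, 0, 1}"
  shows "(tent has_real_derivative
           (if - 1 < x \<and> x < 0 then 1 else if 0 < x \<and> x < 1 then - 1 else 0)) (at x)"
proof -
  consider "x < - 1" | "- 1 < x" "x < 0" | "0 < x" "x < 1" | "1 < x"
    using assms by force
  then show ?thesis
  proof cases
    case 1
    have "((\<lambda>_. 0) has_real_derivative 0) (at x)"
      by simp
    then have "(tent has_real_derivative 0) (at x)"
      by (rule has_field_derivative_transform_within_open[of _ _ _ "{..< - 1}"])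
        (use 1 in \<open>auto simp: tent_def\<close>)
    then show ?thesis using 1 by simp
  next
    case 2
    have "((\<lambda>y. 1 + y) has_real_derivative 1) (at x)"
      by (auto intro!: derivative_eq_intros)
    then have "(tent has_real_derivative 1) (at x)"
      by (rule has_field_derivative_transform_within_open[of _ _ _ "{- 1 <..< 0}"])
        (use 2 in \<open>auto simp: tent_def\<close>)
    then show ?thesis using 2 by simp
  next
    case 3
    have "((\<lambda>y. 1 - y) has_real_derivative - 1) (at x)"
      by (auto intro!: derivative_eq_intros)
    then have "(tent has_real_derivative - 1) (at x)"
      by (rule has_field_derivative_transform_within_open[of _ _ _ "{0 <..< 1}"])
        (use 3 in \<open>auto simp: tent_def\<close>)
    then show ?thesis using 3 by simp
  next
    case 4
    have "((\<lambda>_. 0) has_real_derivative 0) (at x)"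
      by simp
    then have "(tent has_real_derivative 0) (at x)"
      by (rule has_field_derivative_transform_within_open[of _ _ _ "{1 <..}"])
        (use 4 in \<open>auto simp: tent_def\<close>)
    then show ?thesis using 4 by simp
  qed
qed

lemma schauder_0: "0 \<le> t \<Longrightarrow> schauder 0 t = t"
  by (simp add: schauder_def haar_def[abs_def])

text \<open>Off its three kinks the tent has the Haar function as derivative, so the fundamental
  theorem of calculus with a finite exceptional set applies, whatever values \<open>haar\<close>
  takes at its jumps.\<close>

lemma schauder_dyadic:
  assumes l: "l < 2 ^ k" and t: "0 \<le> t"
  shows "schauder (2 ^ k + l) t = sqrt (2 ^ k) / 2 ^ (k + 1) * tent (2 ^ (k + 1) * t - (2 * real l + 1))"
proof -
  define p where "p = (2::real) ^ (k + 1)"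
  define q where "q = 2 * real l + 1"
  have p: "p > 0"
    by (simp add: p_def)
  let ?f = "\<lambda>x. sqrt (2 ^ k) / p * tent (p * x - q)"
  have deriv: "(?f has_vector_derivative haar (2 ^ k + l) x) (at x)"
    if x: "x \<in> {0<..<t} - {(q - 1) / p, q / p, (q + 1) / p}" for x
  proof -
    define y where "y = p * x - q"
    have y: "(q - 1) / p \<le> x \<longleftrightarrow> - 1 \<le> y" "x < q / p \<longleftrightarrow> y < 0" "q / p \<le> x \<longleftrightarrow> 0 \<le> y"
      "x \<le> (q + 1) / p \<longleftrightarrow> y \<le> 1"
      using p by (auto simp: y_def field_simps)
    have ne: "y \<notin> {- 1, 0, 1}"
      using x p by (auto simp: y_def field_simps)
    let ?d = "if - 1 < y \<and> y < 0 then 1 else if 0 < y \<and> y < 1 then - 1 else (0::real)"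
    have "((\<lambda>x. p * x - q) has_real_derivative p) (at x)"
      by (auto intro!: derivative_eq_intros)
    then have "((\<lambda>x. tent (p * x - q)) has_real_derivative ?d * p) (at x)"
      using tent_has_real_derivative[OF ne] unfolding y_def by (intro DERIV_chain2[where f = tent])
    then have "(?f has_real_derivative sqrt (2 ^ k) / p * (?d * p)) (at x)"
      by (rule DERIV_cmult)
    moreover have "haar (2 ^ k + l) x
      = (if (q - 1) / p \<le> x \<and> x < q / p then sqrt (2 ^ k)
         else if q / p \<le> x \<and> x \<le> (q + 1) / p then - sqrt (2 ^ k) else 0)"
    proof -
      have "q - 1 = 2 * real l" "q + 1 = 2 * real l + 2" "2 ^ k + l \<noteq> 0"
        by (simp_all add: q_def)
      then show ?thesis
        by (simp only: haar_def Let_def dyadic_level_eq[OF l] dyadic_pos_eq[OF l] p_def if_False)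
          (simp only: q_def)
    qed
    moreover have "\<dots> = sqrt (2 ^ k) / p * (?d * p)"
      unfolding y using ne p by auto
    ultimately show ?thesis
      by (simp add: has_real_derivative_iff_has_vector_derivative)
  qed
  have "(haar (2 ^ k + l) has_integral ?f t - ?f 0) {0..t}"
    using t p
    by (intro fundamental_theorem_of_calculus_interior_strong[where S = "{(q - 1) / p, q / p, (q + 1) / p}"] deriv)
      (auto intro!: continuous_intros)
  \<comment> \<open>The boundary term at 0 vanishes because \<open>q \<ge> 1\<close>.\<close>
  moreover have "tent (- q) = 0"
    by (simp add: tent_def q_def)
  ultimately show ?thesis
    by (auto simp: schauder_def p_def q_def dest!: integral_unique)
qed

lemma schauder_at_0: "schauder n 0 = 0"
  by (simp add: schauder_def)

subsection \<open>Sums over one dyadic level\<close>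

text \<open>The tent is 1-Lipschitz and constant off \<open>[2 * c, 2 * c + 2]\<close>, so only the
  part of \<open>[y, x]\<close> inside this interval contributes. The difference of the clamped
  points is the length of that part.\<close>

lemma abs_tent_diff_le_clamp:
  "\<bar>tent (x - (2 * c + 1)) - tent (y - (2 * c + 1))\<bar>
     \<le> max (2 * c) (min x (2 * c + 2)) - max (2 * c) (min y (2 * c + 2))"
  if "y \<le> x"
  using that unfolding tent_def by (smt (verit))

text \<open>Clamping to \<open>[c, c + 2]\<close> is expressed through clamping to
  \<open>[0, c + 2]\<close> and \<open>[0, c]\<close>, which makes the sum over adjacent intervals
  telescope.\<close>

lemma clamp_eq:
  fixes c x :: real
  assumes "0 \<le> c"
  shows "max c (min x (c + 2)) = max 0 (min x (c + 2)) - max 0 (min x c) + c"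
  using assms by (auto simp: max_def min_def)

lemma sum_clamp:
  "(\<Sum>l<N. max (2 * real l) (min x (2 * real l + 2)) - max (2 * real l) (min y (2 * real l + 2)))
     = max 0 (min x (2 * real N)) - max 0 (min y (2 * real N))"
proof -
  define f where "f n = max 0 (min x (2 * real n)) - max 0 (min y (2 * real n))" for n
  have "max (2 * real l) (min x (2 * real l + 2)) - max (2 * real l) (min y (2 * real l + 2))
      = f (Suc l) - f l" for l
  proof -
    have "2 * real (Suc l) = 2 * real l + 2"
      by simp
    then show ?thesis
      unfolding f_def clamp_eq[OF mult_nonneg_nonneg[OF zero_le_numeral of_nat_0_le_iff]]
      by (simp only:)
  qed
  then have "(\<Sum>l<N. max (2 * real l) (min x (2 * real l + 2)) - max (2 * real l) (min y (2 * real l + 2)))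
      = f N - f 0"
    by (simp only: sum_lessThan_telescope)
  also have "f 0 = 0"
    by (simp add: f_def)
  finally show ?thesis
    by (simp only: f_def diff_zero)
qed

lemma sum_tent_diff_le_dist:
  "(\<Sum>l<N. \<bar>tent (x - (2 * real l + 1)) - tent (y - (2 * real l + 1))\<bar>) \<le> \<bar>x - y\<bar>"
proof (induction x y rule: linorder_wlog)
  case (le x y)
  have "(\<Sum>l<N. \<bar>tent (y - (2 * real l + 1)) - tent (x - (2 * real l + 1))\<bar>)
      \<le> (\<Sum>l<N. max (2 * real l) (min y (2 * real l + 2)) - max (2 * real l) (min x (2 * real l + 2)))"
    using le by (intro sum_mono abs_tent_diff_le_clamp)
  also have "\<dots> \<le> \<bar>x - y\<bar>"
    using le unfolding sum_clamp by (simp add: max_def min_def)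
  finally show ?case
    by (simp add: abs_minus_commute)
next
  case (sym x y)
  then show ?case
    by (simp add: abs_minus_commute)
qed

lemma sum_tent_le_1: "(\<Sum>l<N. tent (x - (2 * real l + 1))) \<le> 1"
proof -
  \<comment> \<open>The induction also has to know that the sum is 0 from \<open>2 * N\<close> on,
    where the next tent begins; left of \<open>2 * N\<close> that tent adds nothing.\<close>
  have "(\<Sum>l<N. tent (x - (2 * real l + 1))) \<le> min 1 (max 0 (2 * real N - x))"
  proof (induction N)
    case (Suc N)
    show ?case
      using Suc unfolding sum.lessThan_Suc tent_def by (auto simp: max_def min_def split: if_splits)
  qed auto
  then show ?thesis by simp
qed

text \<open>The tents at one point add up to at most 1. The constant is 2 because the two points may
  lie below different tents.\<close>

lemma sum_tent_diff_le:
  "(\<Sum>l<N. \<bar>tent (x - (2 * real l + 1)) - tent (y - (2 * real l + 1))\<bar>) \<le> min 2 \<bar>x - y\<bar>"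
proof -
  have "(\<Sum>l<N. \<bar>tent (x - (2 * real l + 1)) - tent (y - (2 * real l + 1))\<bar>)
      \<le> (\<Sum>l<N. tent (x - (2 * real l + 1)) + tent (y - (2 * real l + 1)))"
  proof (rule sum_mono)
    show "\<bar>tent (x - (2 * real l + 1)) - tent (y - (2 * real l + 1))\<bar>
        \<le> tent (x - (2 * real l + 1)) + tent (y - (2 * real l + 1))" for l
      using tent_nonneg[of "x - (2 * real l + 1)"] tent_nonneg[of "y - (2 * real l + 1)"] by linarith
  qed
  also have "\<dots> \<le> 2"
    using sum_tent_le_1[of x N] sum_tent_le_1[of y N] by (simp add: sum.distrib)
  finally show ?thesis
    using sum_tent_diff_le_dist by simp
qed

section \<open>Normalised Schauder functions and their increments on one level\<close>

definition hat :: "real \<Rightarrow> nat \<Rightarrow> real \<Rightarrow> real" where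
  "hat \<alpha> n t = schauder n t / haar_weight \<alpha> n"

lemma haar_weight_pos: "0 < haar_weight \<alpha> n"
  by (simp add: haar_weight_def)

lemma hat_0: "0 \<le> t \<Longrightarrow> hat \<alpha> 0 t = t"
  by (simp add: hat_def haar_weight_def schauder_0)

lemma sqrt_power_eq_powr: "sqrt (2 ^ k) = 2 powr (real k / 2)"
  by (simp add: powr_half_sqrt[symmetric] powr_realpow[symmetric] powr_powr)

text \<open>The exponents of \<open>sqrt (2 ^ k)\<close>, of \<open>1 / 2 ^ (k + 1)\<close> and of
  the inverse weight add up to \<open>- \<alpha> * (k + 1)\<close>. Writing this as a power of
  \<open>2 powr - \<alpha>\<close> prepares the geometric sums.\<close>

lemma hat_dyadic:
  assumes l: "l < 2 ^ k" and t: "0 \<le> t"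
  shows "hat \<alpha> (2 ^ k + l) t
    = (2 powr - \<alpha>) ^ (k + 1) * tent (2 ^ (k + 1) * t - (2 * real l + 1))"
proof -
  have "haar_weight \<alpha> (2 ^ k + l) = 2 powr (real k * (\<alpha> - 1 / 2) + \<alpha> - 1)"
    using l by (simp add: haar_weight_def dyadic_level_eq)
  moreover have "(2::real) ^ (k + 1) = 2 powr real (k + 1)"
    by (simp only: powr_realpow zero_less_numeral)
  ultimately have "sqrt (2 ^ k) / 2 ^ (k + 1) / haar_weight \<alpha> (2 ^ k + l)
      = 2 powr (real k / 2 - real (k + 1) - (real k * (\<alpha> - 1 / 2) + \<alpha> - 1))"
    by (simp only: powr_diff sqrt_power_eq_powr)
  also have "real k / 2 - real (k + 1) - (real k * (\<alpha> - 1 / 2) + \<alpha> - 1) = - \<alpha> * real (k + 1)"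
    by (simp add: field_simps)
  also have "2 powr \<dots> = (2 powr - \<alpha>) ^ (k + 1)"
    by (simp only: powr_powr[symmetric] powr_realpow powr_gt_zero simp_thms)
  finally have "sqrt (2 ^ k) / 2 ^ (k + 1) = (2 powr - \<alpha>) ^ (k + 1) * haar_weight \<alpha> (2 ^ k + l)"
    using haar_weight_pos[of \<alpha> "2 ^ k + l"] by (simp only: divide_eq_eq) simp
  then show ?thesis
    using haar_weight_pos[of \<alpha> "2 ^ k + l"] unfolding hat_def schauder_dyadic[OF l t] by simp
qed

lemma sum_lessThan_add:
  fixes f :: "nat \<Rightarrow> 'a::comm_monoid_add"
  shows "(\<Sum>n<M + N. f n) = (\<Sum>n<M. f n) + (\<Sum>n<N. f (M + n))"
  by (induction N) (simp_all add: add.assoc)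

text \<open>Passing from \<open>K\<close> to \<open>Suc K\<close> doubles the range, and the new
  half is the block of level \<open>K\<close>.\<close>

lemma sum_lessThan_dyadic:
  fixes f :: "nat \<Rightarrow> 'a::comm_monoid_add"
  shows "(\<Sum>n<2 ^ K. f n) = f 0 + (\<Sum>k<K. \<Sum>l<2 ^ k. f (2 ^ k + l))"
proof (induction K)
  case (Suc K)
  show ?case
    unfolding power_Suc mult_2 sum_lessThan_add sum.lessThan_Suc Suc.IH by (rule add.assoc)
qed (simp only: power_0 lessThan_0 sum.empty One_nat_def sum.lessThan_Suc add_0_left add_0_right)

lemma sum_hat_diff_level_le:
  assumes "0 \<le> s" "0 \<le> t"
  shows "(\<Sum>l<2 ^ k. \<bar>hat \<alpha> (2 ^ k + l) t - hat \<alpha> (2 ^ k + l) s\<bar>)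
    \<le> (2 powr - \<alpha>) ^ (k + 1) * min 2 (2 ^ (k + 1) * \<bar>t - s\<bar>)"
proof -
  have "(\<Sum>l<2 ^ k. \<bar>hat \<alpha> (2 ^ k + l) t - hat \<alpha> (2 ^ k + l) s\<bar>)
    = (\<Sum>l<2 ^ k. (2 powr - \<alpha>) ^ (k + 1) * \<bar>tent (2 ^ (k + 1) * t - (2 * real l + 1))
         - tent (2 ^ (k + 1) * s - (2 * real l + 1))\<bar>)"
    by (intro sum.cong refl)
      (simp only: lessThan_iff hat_dyadic assms abs_mult power_abs abs_of_nonneg[OF powr_ge_zero]
         right_diff_distrib[symmetric])
  also have "\<dots> \<le> (2 powr - \<alpha>) ^ (k + 1) * min 2 \<bar>2 ^ (k + 1) * t - 2 ^ (k + 1) * s\<bar>"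
    unfolding sum_distrib_left[symmetric] by (intro mult_left_mono sum_tent_diff_le) simp
  also have "\<bar>2 ^ (k + 1) * t - 2 ^ (k + 1) * s\<bar> = 2 ^ (k + 1) * \<bar>t - s\<bar>"
    by (simp add: abs_mult flip: right_diff_distrib)
  finally show ?thesis .
qed

section \<open>Summation over all levels\<close>

lemma dyadic_scale:
  fixes h :: real
  assumes "0 < h" "h \<le> 1"
  obtains J :: nat where "1 \<le> 2 ^ J * h" "2 ^ J * h \<le> 2"
proof -
  \<comment> \<open>Minimality gives \<open>2 ^ (J - 1) * h < 1\<close>, hence the upper bound 2;
    for \<open>J = 0\<close> that bound comes from \<open>h \<le> 1\<close>.\<close>
  define J where "J = (LEAST J. 1 \<le> 2 ^ J * h)"
  obtain n where "1 / h < 2 ^ n"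
    using real_arch_pow[of 2 "1 / h"] by auto
  then have "1 \<le> 2 ^ n * h"
    using assms by (simp add: field_simps)
  then have J: "1 \<le> 2 ^ J * h"
    unfolding J_def by (rule LeastI)
  have "2 ^ J * h \<le> 2"
  proof (cases J)
    case (Suc i)
    then have "\<not> 1 \<le> 2 ^ i * h"
      using not_less_Least[of i "\<lambda>J. 1 \<le> 2 ^ J * h"] by (simp add: J_def)
    then show ?thesis
      by (simp add: Suc)
  qed (use assms in simp)
  with J show ?thesis
    by (rule that)
qed

definition schauder_bound :: "real \<Rightarrow> real" where
  "schauder_bound \<alpha> = 2 / ((2 powr \<alpha> - 1) * (2 powr (1 - \<alpha>) - 1))"

lemma sum_levels_le:
  assumes \<alpha>: "0 < \<alpha>" "\<alpha> < 1" and h: "0 < h" "h \<le> 1"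
  shows "(\<Sum>j<N. (2 powr - \<alpha>) ^ j * min 2 (2 ^ j * h)) \<le> schauder_bound \<alpha> * h powr \<alpha>"
proof -
  define a b q where "a = 2 powr \<alpha>" and "b = 2 powr (1 - \<alpha>)" and "q = 2 powr - \<alpha>"
  have a: "a > 1" and b: "b > 1" and q: "0 < q" "q < 1"
    using \<alpha> by (simp_all add: a_def b_def q_def powr_less_one)
  have ab: "a * b = 2" and bq: "b = 2 * q" and aq: "a * q = 1"
    by (simp_all add: a_def b_def q_def flip: powr_add) (simp_all add: powr_diff powr_minus field_simps)
  obtain J where J: "1 \<le> 2 ^ J * h" "2 ^ J * h \<le> 2"
    using dyadic_scale[OF h] .
  \<comment> \<open>All terms are nonnegative. Lengthening the sum to \<open>Suc J + N\<close> terms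
    avoids comparing \<open>N\<close> with \<open>J\<close>.\<close>
  have "(\<Sum>j<N. q ^ j * min 2 (2 ^ j * h)) \<le> (\<Sum>j<Suc J + N. q ^ j * min 2 (2 ^ j * h))"
    using q h by (intro sum_mono2) auto
  also have "\<dots> = (\<Sum>j<Suc J. q ^ j * min 2 (2 ^ j * h))
      + (\<Sum>j<N. q ^ (Suc J + j) * min 2 (2 ^ (Suc J + j) * h))"
    by (rule sum_lessThan_add)
  \<comment> \<open>Up to level \<open>J\<close> the linear branch of the minimum gives a growing
    geometric sum of ratio \<open>2 * q = b\<close>; beyond \<open>J\<close> the constant branch
    gives a decaying one of ratio \<open>q\<close>.\<close>
  also have "\<dots> \<le> (\<Sum>j<Suc J. h * b ^ j) + (\<Sum>j<N. 2 * q ^ Suc J * q ^ j)"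
  proof (intro add_mono sum_mono)
    fix j
    have "q ^ j * min 2 (2 ^ j * h) \<le> q ^ j * (2 ^ j * h)"
      using q by (intro mult_left_mono) auto
    then show "q ^ j * min 2 (2 ^ j * h) \<le> h * b ^ j"
      by (simp add: bq power_mult_distrib ac_simps)
    have "q ^ (Suc J + j) * min 2 (2 ^ (Suc J + j) * h) \<le> q ^ (Suc J + j) * 2"
      using q by (intro mult_left_mono) auto
    then show "q ^ (Suc J + j) * min 2 (2 ^ (Suc J + j) * h) \<le> 2 * q ^ Suc J * q ^ j"
      by (simp add: power_add ac_simps)
  qed
  also have "(\<Sum>j<Suc J. h * b ^ j) \<le> h * (b ^ Suc J / (b - 1))"
    using b h geometric_sum[of b "Suc J"]
    by (auto simp: sum_distrib_left[symmetric] divide_right_mono simp del: power_Suc sum.lessThan_Suc)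
  also have "(\<Sum>j<N. 2 * q ^ Suc J * q ^ j) \<le> 2 * q ^ Suc J * (1 / (1 - q))"
  proof -
    have "(\<Sum>j<N. q ^ j) = (1 - q ^ N) / (1 - q)"
      using q by (simp add: sum_gp_strict)
    also have "\<dots> \<le> 1 / (1 - q)"
      using q by (intro divide_right_mono) auto
    finally show ?thesis
      unfolding sum_distrib_left[symmetric] using q by (intro mult_left_mono) auto
  qed
  \<comment> \<open>Both sums are of the order of the crossover level; \<open>q ^ J\<close> is
    factored out, since it is comparable with \<open>h powr \<alpha>\<close>.\<close>
  also have "h * (b ^ Suc J / (b - 1)) + 2 * q ^ Suc J * (1 / (1 - q))
      = q ^ J * ((2 ^ J * h) * b / (b - 1) + 2 / (a - 1))"
  proof -
    have "q / (1 - q) = 1 / (a - 1)"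
      using aq a q by (simp add: field_simps)
    then have "2 * q ^ Suc J * (1 / (1 - q)) = q ^ J * (2 / (a - 1))"
      by (metis (no_types, opaque_lifting) mult.assoc mult.commute mult.right_neutral
          power_Suc times_divide_eq_right)
    moreover have "h * (b ^ Suc J / (b - 1)) = q ^ J * ((2 ^ J * h) * b / (b - 1))"
      by (simp add: bq power_mult_distrib)
    ultimately show ?thesis
      by (simp add: distrib_left)
  qed
  \<comment> \<open>The lower bound \<open>1 \<le> 2 ^ J * h\<close> says
    \<open>2 powr - J \<le> h\<close>, and \<open>q ^ J\<close> is the \<open>\<alpha>\<close>-th
    power of the left side.\<close>
  also have "\<dots> \<le> h powr \<alpha> * ((2 ^ J * h) * b / (b - 1) + 2 / (a - 1))"
  proof (rule mult_right_mono)
    have "q ^ J = q powr real J"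
      using q by (simp only: powr_realpow)
    also have "\<dots> = (2 powr - real J) powr \<alpha>"
      by (simp add: q_def powr_powr mult.commute)
    also have "\<dots> \<le> h powr \<alpha>"
    proof (rule powr_mono2)
      show "2 powr - real J \<le> h"
        using J by (simp add: powr_minus_divide powr_realpow field_simps)
    qed (use \<alpha> in simp_all)
    finally show "q ^ J \<le> h powr \<alpha>" .
  qed (use a b h in simp)
  \<comment> \<open>The bracket increases with \<open>2 ^ J * h\<close>, so its value at 2 is an
    upper bound. There \<open>a * b = 2\<close> reduces the numerator over
    \<open>(a - 1) * (b - 1)\<close> to \<open>2 * (2 - b) + 2 * (b - 1) = 2\<close>.\<close>
  also have "\<dots> \<le> h powr \<alpha> * schauder_bound \<alpha>"
  proof (rule mult_left_mono)
    have "(2 ^ J * h) * b / (b - 1) + 2 / (a - 1) = ((2 ^ J * h) * (2 - b) + 2 * (b - 1)) / ((a - 1) * (b - 1))"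
    proof -
      have "(2 ^ J * h) * b / (b - 1) + 2 / (a - 1)
          = ((2 ^ J * h) * (b * (a - 1)) + 2 * (b - 1)) / ((a - 1) * (b - 1))"
        using a b by (simp add: add_frac_eq ac_simps)
      moreover have "b * (a - 1) = 2 - b"
        using ab by (simp add: algebra_simps)
      ultimately show ?thesis by simp
    qed
    also have "\<dots> \<le> 2 / ((a - 1) * (b - 1))"
    proof (rule divide_right_mono)
      have "b \<le> 2"
        using bq q by simp
      then have "(2 ^ J * h) * (2 - b) \<le> 2 * (2 - b)"
        using J by (intro mult_right_mono) auto
      then show "(2 ^ J * h) * (2 - b) + 2 * (b - 1) \<le> 2"
        by (simp add: algebra_simps)
    qed (use a b in simp)
    finally show "(2 ^ J * h) * b / (b - 1) + 2 / (a - 1) \<le> schauder_bound \<alpha>"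
      by (simp add: schauder_bound_def a_def b_def)
  qed simp
  finally show ?thesis
    by (simp add: q_def mult.commute)
qed

text \<open>The bound is free of \<open>N\<close> and has the absolute values inside the sum, so it
  controls every series with bounded coefficients as well as its tails.\<close>

lemma sum_hat_diff_le:
  assumes \<alpha>: "0 < \<alpha>" "\<alpha> < 1" and st: "s \<in> {0..1}" "t \<in> {0..1}"
  shows "(\<Sum>n<N. \<bar>hat \<alpha> n t - hat \<alpha> n s\<bar>) \<le> schauder_bound \<alpha> * \<bar>t - s\<bar> powr \<alpha>"
proof (cases "s = t")
  case False
  let ?f = "\<lambda>j. (2 powr - \<alpha>) ^ j * min 2 (2 ^ j * \<bar>t - s\<bar>)"
  \<comment> \<open>The index set is enlarged to complete levels, using
    \<open>N < 2 ^ N\<close>.\<close>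
  have "(\<Sum>n<N. \<bar>hat \<alpha> n t - hat \<alpha> n s\<bar>) \<le> (\<Sum>n<2 ^ N. \<bar>hat \<alpha> n t - hat \<alpha> n s\<bar>)"
  proof (rule sum_mono2)
    show "{..<N} \<subseteq> {..<2 ^ N}"
      using less_exp[of N] unfolding lessThan_subset_iff by (rule less_imp_le)
  qed (rule finite_lessThan abs_ge_zero)+
  also have "\<dots> = \<bar>hat \<alpha> 0 t - hat \<alpha> 0 s\<bar>
      + (\<Sum>k<N. \<Sum>l<2 ^ k. \<bar>hat \<alpha> (2 ^ k + l) t - hat \<alpha> (2 ^ k + l) s\<bar>)"
    by (rule sum_lessThan_dyadic)
  also have "\<dots> \<le> \<bar>t - s\<bar> + (\<Sum>k<N. ?f (Suc k))"
  proof (intro add_mono sum_mono)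
    show "\<bar>hat \<alpha> 0 t - hat \<alpha> 0 s\<bar> \<le> \<bar>t - s\<bar>"
      using st by (simp add: hat_0)
    show "(\<Sum>l<2 ^ k. \<bar>hat \<alpha> (2 ^ k + l) t - hat \<alpha> (2 ^ k + l) s\<bar>) \<le> ?f (Suc k)" for k
      using st sum_hat_diff_level_le[of s t \<alpha> k] by (simp only: Suc_eq_plus1 atLeastAtMost_iff)
  qed
  also have "\<dots> = (\<Sum>j<Suc N. ?f j)"
  proof -
    \<comment> \<open>The linear function \<open>hat \<alpha> 0\<close> takes the place of level
      \<open>j = 0\<close>: as \<open>\<bar>t - s\<bar> \<le> 1\<close>, the minimum is
      \<open>\<bar>t - s\<bar>\<close> itself.\<close>
    have "?f 0 = \<bar>t - s\<bar>"
      using st by auto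
    then show ?thesis
      by (simp only: sum.lessThan_Suc_shift)
  qed
  also have "\<dots> \<le> schauder_bound \<alpha> * \<bar>t - s\<bar> powr \<alpha>"
    using False st by (intro sum_levels_le \<alpha>) auto
  finally show ?thesis .
qed simp

subsection \<open>Biorthogonality of the Haar integrals and the Schauder functions\<close>

lemma haar_integral_0: "haar_integral 0 F = F 1 - F 0"
  by (simp add: haar_integral_def)

lemma haar_integral_dyadic:
  assumes "l < 2 ^ k"
  shows "haar_integral (2 ^ k + l) F = sqrt (2 ^ k) *\<^sub>R
    (2 *\<^sub>R F ((2 * real l + 1) / 2 ^ (k + 1)) - F ((2 * real l + 2) / 2 ^ (k + 1))
       - F (2 * real l / 2 ^ (k + 1)))"
proof -
  have "2 ^ k + l \<noteq> 0"
    by simp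
  then show ?thesis
    by (simp only: haar_integral_def Let_def dyadic_level_eq[OF assms] dyadic_pos_eq[OF assms] if_False)
qed

lemma dyadic_nodes:
  assumes "l < 2 ^ k"
  shows "2 * real l / 2 ^ (k + 1) \<in> {0..1}" "(2 * real l + 1) / 2 ^ (k + 1) \<in> {0..1}"
    "(2 * real l + 2) / 2 ^ (k + 1) \<in> {0..1}"
proof -
  have "real l + 1 \<le> 2 ^ k"
    using assms by (metis Suc_eq_plus1 Suc_leI of_nat_1 of_nat_add of_nat_le_numeral_power_cancel_iff)
  then show "2 * real l / 2 ^ (k + 1) \<in> {0..1}" "(2 * real l + 1) / 2 ^ (k + 1) \<in> {0..1}"
    "(2 * real l + 2) / 2 ^ (k + 1) \<in> {0..1}"
    using assms by (simp_all add: field_simps)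
qed

lemma dyadic_cases [case_names 0 dyadic]:
  fixes n :: nat
  obtains "n = 0" | k l where "l < 2 ^ k" "n = 2 ^ k + l"
proof (cases "n = 0")
  case False
  then show ?thesis
    using dyadic_decomp[of n] that(2)[of "dyadic_pos n" "dyadic_level n"] by simp
qed (rule that(1))

lemma tent_of_int: "tent (of_int i) = (if i = 0 then 1 else 0)"
proof (cases "i = 0")
  case False
  then have "1 \<le> \<bar>real_of_int i\<bar>"
    by linarith
  then show ?thesis
    using False by (simp add: tent_def)
qed (simp add: tent_def)

text \<open>All kinks of \<open>tent\<close> are integers, so it is affine between consecutive ones.
  This makes second differences of coarser Schauder functions vanish.\<close>

lemma tent_midpoint:
  assumes "real_of_int i \<le> x" "x \<le> z" "z \<le> real_of_int i + 1"
  shows "2 * tent ((x + z) / 2) = tent x + tent z"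
proof -
  consider "i \<le> - 2" | "i = - 1" | "i = 0" | "1 \<le> i"
    by linarith
  then show ?thesis
  proof cases
    case 1
    then have "real_of_int i \<le> - 2"
      by linarith
    then have "x \<le> - 1" "z \<le> - 1" "(x + z) / 2 \<le> - 1"
      using assms by simp_all
    then show ?thesis
      by (simp add: tent_def)
  next
    case 4
    then have "1 \<le> real_of_int i"
      by linarith
    then have "1 \<le> x" "1 \<le> z" "1 \<le> (x + z) / 2"
      using assms by simp_all
    then show ?thesis
      by (simp add: tent_def)
  qed (use assms in \<open>simp_all add: tent_def field_simps\<close>)
qed

text \<open>For \<open>m > 0\<close> the Haar integral is a second difference at three equally
  spaced nodes. A Schauder function of coarser level is affine across them, one of finer level is 0
  at all three, and on the same level only the matching peak is seen.\<close>

lemma haar_integral_schauder: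
  "haar_integral m (schauder n) = (if m = n then 1 else 0)"
proof (cases m rule: dyadic_cases)
  case 0
  show ?thesis
  proof (cases n rule: dyadic_cases)
    case (dyadic j i)
    have "schauder n 1 = 0"
    proof -
      have "tent (2 ^ (j + 1) * 1 - (2 * real i + 1)) = tent (of_int (2 ^ (j + 1) - (2 * int i + 1)))"
        by simp
      \<comment> \<open>The integer argument is odd, hence not 0.\<close>
      also have "\<dots> = 0"
        unfolding tent_of_int by simp presburger
      finally show ?thesis
        unfolding dyadic(2) schauder_dyadic[OF dyadic(1) zero_le_one] by simp
    qed
    then show ?thesis
      using 0 dyadic by (simp add: haar_integral_0 schauder_at_0)
  qed (simp add: 0 haar_integral_0 schauder_0)
next
  case m: (dyadic k l)
  note nodes = dyadic_nodes[OF m(1), unfolded atLeastAtMost_iff, THEN conjunct1]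
  show ?thesis
  proof (cases n rule: dyadic_cases)
    case 0
    then show ?thesis
      unfolding m(2) haar_integral_dyadic[OF m(1)] by (simp only: schauder_0 nodes)
       (simp add: field_simps)
  next
    case n: (dyadic j i)
    define T where "T r = tent (2 ^ (j + 1) * ((2 * real l + r) / 2 ^ (k + 1)) - (2 * real i + 1))" for r
    have eq: "haar_integral m (schauder n)
        = sqrt (2 ^ k) * (sqrt (2 ^ j) / 2 ^ (j + 1)) * (2 * T 1 - T 2 - T 0)"
      unfolding m(2) n(2) haar_integral_dyadic[OF m(1)]
      by (simp only: schauder_dyadic[OF n(1)] nodes T_def) (simp add: algebra_simps)
    consider "j < k" | "j = k" | "k < j"
      by linarith
    then show ?thesis
    proof cases
      case 1
      define D where "D = (2::nat) ^ (k - j - 1)"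
      have D: "D > 0" "(2::real) ^ (k + 1) = 2 ^ (j + 1) * (2 * real D)"
        using 1 by (simp_all add: D_def flip: power_add power_Suc)
      define y where "y r = (2 * real l + r) / (2 * real D)" for r
      have T: "T r = tent (y r - (2 * real i + 1))" for r
      proof -
        have "2 ^ (j + 1) * ((2 * real l + r) / 2 ^ (k + 1)) = y r"
          unfolding y_def D(2) by (simp add: divide_simps)
        then show ?thesis
          by (simp only: T_def)
      qed
      \<comment> \<open>In the coordinate \<open>2 ^ (j + 1) * t\<close> the nodes span
        \<open>[l / D, (l + 1) / D]\<close>, which lies between the consecutive integers
        \<open>l div D\<close> and \<open>l div D + 1\<close>.\<close>
      have "l div D * D \<le> l" "l + 1 \<le> (l div D + 1) * D"
        using D(1) by (simp_all add: Suc_leI dividend_less_div_times div_times_less_eq_dividend add.commute)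
      then have "real (l div D) * real D \<le> real l" "real l + 1 \<le> (real (l div D) + 1) * real D"
        by (metis of_nat_mult of_nat_le_iff, metis of_nat_mult of_nat_le_iff of_nat_add of_nat_1)
      then have y: "real (l div D) \<le> y 0" "y 2 \<le> real (l div D) + 1"
        using D(1) by (simp_all add: y_def field_simps)
      have "2 * tent (((y 0 - (2 * real i + 1)) + (y 2 - (2 * real i + 1))) / 2)
          = tent (y 0 - (2 * real i + 1)) + tent (y 2 - (2 * real i + 1))"
      proof (rule tent_midpoint[of "int (l div D) - (2 * int i + 1)"])
        show "y 0 - (2 * real i + 1) \<le> y 2 - (2 * real i + 1)"
          unfolding y_def by (intro diff_right_mono divide_right_mono) simp_all
      qed (use y in simp_all)
      moreover have "((y 0 - (2 * real i + 1)) + (y 2 - (2 * real i + 1))) / 2 = y 1 - (2 * real i + 1)"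
        using D(1) by (simp add: y_def field_simps)
      ultimately have "2 * T 1 = T 0 + T 2"
        by (simp only: T)
      then have "2 * T 1 - T 2 - T 0 = 0"
        by simp
      moreover have "m \<noteq> n"
        using 1 m n by (metis dyadic_level_eq less_irrefl)
      ultimately show ?thesis
        by (simp add: eq)
    next
      case 2
      have T: "T (of_int r) = tent (of_int (2 * int l - 2 * int i - 1 + r))" for r
      proof -
        have "2 ^ (k + 1) * (x / 2 ^ (k + 1)) = x" for x :: real
          by simp
        then show ?thesis
          by (simp only: T_def 2) (simp add: algebra_simps)
      qed
      \<comment> \<open>The outer nodes have odd arguments, where the tent is 0; the middle one has
        argument \<open>2 * (l - i)\<close>.\<close>
      have "2 * T 1 - T 2 - T 0 = (if l = i then 2 else 0)"
        using T[of 0] T[of 1] T[of 2] unfolding tent_of_int by simp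
      then have "haar_integral m (schauder n)
          = sqrt (2 ^ k) * (sqrt (2 ^ k) / 2 ^ (k + 1)) * (if l = i then 2 else 0)"
        by (simp only: eq 2)
      also have "\<dots> = (if l = i then 1 else 0)"
        by simp
      also have "l = i \<longleftrightarrow> m = n"
        using m n 2 by simp
      finally show ?thesis .
    next
      case 3
      then obtain d where d: "j + 1 = d + 1 + (k + 1)"
        by (metis add.commute add_Suc_right less_iff_Suc_add plus_1_eq_Suc)
      have T: "T (of_int r) = tent (of_int (2 * (2 ^ d * (2 * int l + r)) - (2 * int i + 1)))" for r
        unfolding T_def d power_add by simp
      \<comment> \<open>The argument is an even integer minus an odd one, hence a nonzero
        integer.\<close>
      have "T (of_int r) = 0" for r
        unfolding T tent_of_int by presburger
      from this[of 0] this[of 1] this[of 2] have "2 * T 1 - T 2 - T 0 = 0"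
        by simp
      moreover have "m \<noteq> n"
        using 3 m n by (metis dyadic_level_eq less_irrefl)
      ultimately show ?thesis
        by (simp add: eq)
    qed
  qed
qed

lemma haar_integral_scaleR_left:
  "haar_integral n (\<lambda>t. f t *\<^sub>R v) = haar_integral n f *\<^sub>R v"
  by (simp add: haar_integral_def Let_def scaleR_diff_left flip: scaleR_scaleR)

lemma haar_integral_diff:
  "haar_integral n (\<lambda>t. F t - G t) = haar_integral n F - haar_integral n G"
  by (simp add: haar_integral_def Let_def algebra_simps)

lemma haar_integral_sum:
  fixes F :: "nat \<Rightarrow> real \<Rightarrow> 'a::real_vector"
  shows "haar_integral n (\<lambda>t. \<Sum>i<N. F i t) = (\<Sum>i<N. haar_integral n (F i))"
proof (induction N)
  case (Suc N)
  have "haar_integral n (\<lambda>t. G t + H t) = haar_integral n G + haar_integral n H" for G H :: "real \<Rightarrow> 'a"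
    by (simp add: haar_integral_def Let_def algebra_simps)
  then show ?case
    by (simp add: Suc)
qed (simp add: haar_integral_def)

text \<open>A Haar integral is a linear combination of at most three values on
  \<open>[0, 1]\<close>, so pointwise convergence suffices.\<close>

lemma tendsto_haar_integral:
  fixes G :: "real \<Rightarrow> 'a::real_normed_vector"
  assumes "\<And>t. t \<in> {0..1} \<Longrightarrow> (\<lambda>N. S N t) \<longlonglongrightarrow> G t"
  shows "(\<lambda>N. haar_integral n (S N)) \<longlonglongrightarrow> haar_integral n G"
proof (cases n rule: dyadic_cases)
  case 0
  then show ?thesis
    unfolding 0 haar_integral_0 by (intro tendsto_intros assms) auto
next
  case (dyadic k l)
  then show ?thesis
    unfolding dyadic(2) haar_integral_dyadic[OF dyadic(1)]
    by (intro tendsto_intros assms dyadic_nodes)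
qed

text \<open>By biorthogonality the Haar integral of the \<open>N\<close>-th partial sum equals
  \<open>v n\<close> as soon as \<open>N > n\<close>.\<close>

lemma haar_integral_series:
  fixes v :: "nat \<Rightarrow> 'a::real_normed_vector"
  assumes "\<And>t. t \<in> {0..1} \<Longrightarrow> (\<lambda>N. \<Sum>i<N. schauder i t *\<^sub>R v i) \<longlonglongrightarrow> G t"
  shows "haar_integral n G = v n"
proof -
  have "haar_integral n (\<lambda>t. \<Sum>i<N. schauder i t *\<^sub>R v i) = (if n < N then v n else 0)" for N
    by (simp add: haar_integral_sum haar_integral_scaleR_left haar_integral_schauder
        if_distrib[of "\<lambda>c. c *\<^sub>R _"] cong: if_cong)
  moreover have "\<forall>\<^sub>F N in sequentially. (if n < N then v n else 0) = v n"
    using eventually_gt_at_top[of n] by eventually_elim simp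
  ultimately have "(\<lambda>N. haar_integral n (\<lambda>t. \<Sum>i<N. schauder i t *\<^sub>R v i)) \<longlonglongrightarrow> v n"
    by (simp add: tendsto_eventually)
  with tendsto_haar_integral[OF assms, where n = n] show ?thesis
    by (rule LIMSEQ_unique)
qed

section \<open>Functions with vanishing Haar integrals\<close>

text \<open>Vanishing Haar integrals force \<open>F\<close> to be affine across each dyadic midpoint, hence zero at
  all dyadic points.\<close>

lemma haar_integrals_eq_0_imp_eq_0:
  fixes F :: "real \<Rightarrow> 'a::real_normed_vector"
  assumes cont: "continuous_on {0..1} F" and F0: "F 0 = 0"
    and haar: "\<And>n. haar_integral n F = 0" and t: "t \<in> {0..1}"
  shows "F t = 0"
proof -
  have dyadic: "F (real i / 2 ^ k) = 0" if "i \<le> 2 ^ k" for i k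
    using that
  proof (induction k arbitrary: i)
    case 0
    moreover have "F 1 = 0"
      using haar[of 0] F0 by (simp add: haar_integral_0)
    ultimately show ?case
      using F0 by (cases i) auto
  next
    case (Suc k)
    show ?case
    proof (cases "even i")
      case True
      then show ?thesis
        using Suc by (auto elim!: evenE)
    next
      case False
      then obtain l where i: "i = 2 * l + 1"
        by (rule oddE)
      then have l: "l < 2 ^ k"
        using Suc.prems by simp
      have "F (2 * real l / 2 ^ (k + 1)) = 0" "F ((2 * real l + 2) / 2 ^ (k + 1)) = 0"
        using Suc.IH[of l] Suc.IH[of "l + 1"] l by (simp_all add: add_divide_distrib add.commute)
      then have "F ((2 * real l + 1) / 2 ^ (k + 1)) = 0"
        using haar[of "2 ^ k + l"] unfolding haar_integral_dyadic[OF l] by simp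
      then show ?thesis
        by (simp add: i add.commute)
    qed
  qed
  \<comment> \<open>Rounding \<open>t\<close> down to the grid of mesh \<open>1 / 2 ^ k\<close>
    gives dyadic points of \<open>[0, 1]\<close> that converge to \<open>t\<close>.\<close>
  define i where "i k = nat \<lfloor>2 ^ k * t\<rfloor>" for k :: nat
  have i: "real (i k) \<le> 2 ^ k * t" "2 ^ k * t - 1 \<le> real (i k)" for k
    using t by (simp_all add: i_def)
  have u: "real (i k) / 2 ^ k \<le> t" "t - 1 / 2 ^ k \<le> real (i k) / 2 ^ k" for k
  proof -
    show "real (i k) / 2 ^ k \<le> t"
      using i(1)[of k] by (simp add: pos_divide_le_eq mult.commute)
    have "(2 ^ k * t - 1) / 2 ^ k \<le> real (i k) / 2 ^ k"
      using i(2)[of k] by (rule divide_right_mono) simp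
    then show "t - 1 / 2 ^ k \<le> real (i k) / 2 ^ k"
      by (simp add: diff_divide_distrib)
  qed
  have "(\<lambda>k. 1 / 2 ^ k) \<longlonglongrightarrow> (0::real)"
    by (rule LIMSEQ_divide_realpow_zero) simp
  then have "(\<lambda>k. t - 1 / 2 ^ k) \<longlonglongrightarrow> t - 0"
    by (rule tendsto_diff[OF tendsto_const])
  then have "(\<lambda>k. t - 1 / 2 ^ k) \<longlonglongrightarrow> t"
    by (simp only: diff_zero)
  then have lim: "(\<lambda>k. real (i k) / 2 ^ k) \<longlonglongrightarrow> t"
    by (rule tendsto_sandwich[OF always_eventually always_eventually _ tendsto_const, rotated 2])
      (use u in blast)+
  have le1: "real (i k) / 2 ^ k \<le> 1" for k
    by (rule order_trans[OF u(1)]) (use t in simp)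
  have "(\<lambda>k. F (real (i k) / 2 ^ k)) \<longlonglongrightarrow> F t"
    by (rule continuous_on_tendsto_compose[OF cont lim t]) (use le1 in \<open>auto intro!: always_eventually\<close>)
  moreover have "F (real (i k) / 2 ^ k) = 0" for k
  proof (rule dyadic)
    have "real (i k) \<le> real (2 ^ k)"
      using le1[of k] by simp
    then show "i k \<le> 2 ^ k"
      by (simp only: of_nat_le_iff)
  qed
  ultimately show ?thesis
    by (simp add: LIMSEQ_const_iff)
qed

subsection \<open>The transform maps into null sequences and does not increase norms\<close>

text \<open>The second difference is a difference of two increments of length
  \<open>1 / 2 ^ (k + 1)\<close>, and the weight is exactly the inverse of
  \<open>2 * sqrt (2 ^ k) * (1 / 2 ^ (k + 1)) powr \<alpha>\<close>. Since only increments of this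
  one length are assumed bounded, both the norm bound and the decay of the coefficients
  follow.\<close>

lemma norm_haar_transform_le:
  fixes F :: "real \<Rightarrow> 'a::real_normed_vector"
  assumes l: "l < 2 ^ k"
    and F: "\<And>s t. 0 \<le> s \<Longrightarrow> t \<le> 1 \<Longrightarrow> t - s = 1 / 2 ^ (k + 1)
      \<Longrightarrow> norm (F t - F s) \<le> B * (1 / 2 ^ (k + 1)) powr \<alpha>"
  shows "norm (haar_transform \<alpha> F (2 ^ k + l)) \<le> B"
proof -
  let ?d = "(1 / 2 ^ (k + 1)) powr \<alpha>" and ?w = "haar_weight \<alpha> (2 ^ k + l)"
  let ?a = "2 * real l / 2 ^ (k + 1)" and ?m = "(2 * real l + 1) / 2 ^ (k + 1)"
    and ?b = "(2 * real l + 2) / 2 ^ (k + 1)"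
  have "norm (2 *\<^sub>R F ?m - F ?b - F ?a) = norm ((F ?m - F ?a) - (F ?b - F ?m))"
    by (simp add: scaleR_2 algebra_simps)
  also have "\<dots> \<le> norm (F ?m - F ?a) + norm (F ?b - F ?m)"
    by (rule norm_triangle_ineq4)
  also have "\<dots> \<le> B * ?d + B * ?d"
  proof (intro add_mono F)
    show "?m - ?a = 1 / 2 ^ (k + 1)" "?b - ?m = 1 / 2 ^ (k + 1)"
      by (simp_all only: diff_divide_distrib[symmetric]) simp_all
  qed (use dyadic_nodes[OF l] in \<open>simp_all only: atLeastAtMost_iff\<close>)
  finally have *: "norm (2 *\<^sub>R F ?m - F ?b - F ?a) \<le> 2 * B * ?d"
    by simp
  have "haar_weight \<alpha> (2 ^ k + l) = 2 powr (real k * (\<alpha> - 1 / 2) + \<alpha> - 1)"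
    using l by (simp add: haar_weight_def dyadic_level_eq)
  moreover have "?d = 2 powr (- real (k + 1) * \<alpha>)"
  proof -
    have "1 / 2 ^ (k + 1) = 2 powr - real (k + 1)"
      by (simp only: powr_minus_divide powr_realpow zero_less_numeral)
    then show ?thesis
      by (simp only: powr_powr)
  qed
  ultimately have "?w * sqrt (2 ^ k) * 2 * ?d
      = 2 powr ((real k * (\<alpha> - 1 / 2) + \<alpha> - 1) + real k / 2 + 1 + - real (k + 1) * \<alpha>)"
    unfolding powr_add sqrt_power_eq_powr by simp
  also have "(real k * (\<alpha> - 1 / 2) + \<alpha> - 1) + real k / 2 + 1 + - real (k + 1) * \<alpha> = 0"
    by (simp add: field_simps)
  finally have w: "?w * sqrt (2 ^ k) * 2 * ?d = 1"
    by simp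
  have "norm (haar_transform \<alpha> F (2 ^ k + l)) = ?w * sqrt (2 ^ k) * norm (2 *\<^sub>R F ?m - F ?b - F ?a)"
    unfolding haar_transform_def haar_integral_dyadic[OF l] norm_scaleR
    using haar_weight_pos[of \<alpha> "2 ^ k + l"] by simp
  also have "\<dots> \<le> ?w * sqrt (2 ^ k) * (2 * B * ?d)"
    using haar_weight_pos[of \<alpha> "2 ^ k + l"] * by (intro mult_left_mono) simp_all
  also have "\<dots> = (?w * sqrt (2 ^ k) * 2 * ?d) * B"
    by (simp only: ac_simps)
  finally show ?thesis
    by (simp only: w mult_1)
qed

lemma c0_norm_haar_transform_le: "c0_norm (haar_transform \<alpha> F) \<le> holder_norm \<alpha> F"
proof (cases "holder_norm \<alpha> F = top")
  case False
  define B where "B = enn2real (holder_norm \<alpha> F)"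
  have B: "holder_norm \<alpha> F = ennreal B" "0 \<le> B"
    using False by (simp_all add: B_def less_top)
  have F: "norm (F t - F s) \<le> B * (t - s) powr \<alpha>" if "0 \<le> s" "s < t" "t \<le> 1" for s t
    using holder_quotient_le_norm[OF that, of F \<alpha>] that B
    by (simp add: ennreal_le_iff pos_divide_le_eq)
  have "norm (haar_transform \<alpha> F n) \<le> B" for n
  proof (cases n rule: dyadic_cases)
    case 0
    then show ?thesis
      using F[of 0 1] by (simp add: haar_transform_def haar_integral_0 haar_weight_def)
  next
    case (dyadic k l)
    show ?thesis
      unfolding dyadic(2)
    proof (rule norm_haar_transform_le[OF dyadic(1)])
      fix s t :: real
      assume st: "0 \<le> s" "t \<le> 1" "t - s = 1 / 2 ^ (k + 1)"
      moreover have "0 < 1 / (2::real) ^ (k + 1)"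
        by simp
      ultimately have "s < t"
        by linarith
      with F[of s t] st show "norm (F t - F s) \<le> B * (1 / 2 ^ (k + 1)) powr \<alpha>"
        by simp
    qed
  qed
  then show ?thesis
    unfolding c0_norm_def B by (intro SUP_least ennreal_leI)
qed simp

lemma haar_transform_in_c0_space:
  assumes "F \<in> holder0_space \<alpha>"
  shows "haar_transform \<alpha> F \<in> c0_space"
  unfolding c0_space_def mem_Collect_eq
proof (rule LIMSEQ_I)
  fix \<epsilon> :: real
  assume "0 < \<epsilon>"
  then obtain \<delta> where \<delta>: "\<delta> > 0" and F: "\<And>s t. s \<in> {0..1} \<Longrightarrow> t \<in> {0..1} \<Longrightarrow> \<bar>t - s\<bar> < \<delta>
      \<Longrightarrow> norm (F t - F s) \<le> \<epsilon> / 2 * \<bar>t - s\<bar> powr \<alpha>"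
    using holder0_space_small_increments[OF assms, of "\<epsilon> / 2"] by (metis half_gt_zero)
  obtain K where K: "(1 / 2) ^ K < \<delta>"
    using real_arch_pow_inv[OF \<delta>, of "1 / 2"] by auto
  have "norm (haar_transform \<alpha> F n) \<le> \<epsilon> / 2" if n: "2 ^ K \<le> n" for n
  proof (cases n rule: dyadic_cases)
    case 0
    with n show ?thesis by simp
  next
    case (dyadic k l)
    \<comment> \<open>From \<open>2 ^ K \<le> n < 2 ^ (k + 1)\<close> the mesh
      \<open>1 / 2 ^ (k + 1)\<close> is at most \<open>(1 / 2) ^ K\<close>, hence below
      \<open>\<delta>\<close>.\<close>
    then have "(2::nat) ^ K < 2 ^ Suc k"
      using n by simp
    then have "K \<le> k + 1"
      using power_less_imp_less_exp[of "2::nat" K "Suc k"] by simp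
    then have "(1 / 2) ^ (k + 1) \<le> (1 / 2 :: real) ^ K"
      by (intro power_decreasing) auto
    then have d: "1 / 2 ^ (k + 1) < \<delta>"
      using K by (simp add: power_one_over)
    show ?thesis
      unfolding dyadic(2)
    proof (rule norm_haar_transform_le[OF dyadic(1)])
      fix s t :: real
      assume st: "0 \<le> s" "t \<le> 1" "t - s = 1 / 2 ^ (k + 1)"
      moreover have "0 < 1 / (2::real) ^ (k + 1)"
        by simp
      ultimately have "s < t"
        by linarith
      with F[of s t] st d show "norm (F t - F s) \<le> \<epsilon> / 2 * (1 / 2 ^ (k + 1)) powr \<alpha>"
        by simp
    qed
  qed
  moreover have "\<epsilon> / 2 < \<epsilon>"
    using \<open>0 < \<epsilon>\<close> by simp
  ultimately have "norm (norm (haar_transform \<alpha> F n) - 0) < \<epsilon>" if "2 ^ K \<le> n" for n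
    using that by (simp only: diff_zero real_norm_def abs_norm_cancel) (rule order_le_less_trans)
  then show "\<exists>N. \<forall>n\<ge>N. norm (norm (haar_transform \<alpha> F n) - 0) < \<epsilon>"
    by blast
qed

lemma continuous_map_haar_transform:
  fixes \<alpha> :: real
  assumes "0 < \<alpha>"
  shows "continuous_map (mtopology_of (holder0_metric \<alpha>)) (mtopology_of c0_metric)
    (haar_transform \<alpha> :: (real \<Rightarrow> 'a::real_normed_vector) \<Rightarrow> nat \<Rightarrow> 'a)"
proof (rule Lipschitz_continuous_imp_continuous_map)
  show "Lipschitz_continuous_map (holder0_metric \<alpha>) c0_metric
      (haar_transform \<alpha> :: (real \<Rightarrow> 'a) \<Rightarrow> nat \<Rightarrow> 'a)"
    unfolding Lipschitz_continuous_map_def c0_metric_simps holder0_metric_simps[OF assms]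
  proof (intro conjI exI[of _ 1] ballI)
    fix F G :: "real \<Rightarrow> 'a"
    assume FG: "F \<in> holder0_space \<alpha>" "G \<in> holder0_space \<alpha>"
    have "(\<lambda>n. haar_transform \<alpha> F n - haar_transform \<alpha> G n) = haar_transform \<alpha> (\<lambda>t. F t - G t)"
      by (simp add: haar_transform_def haar_integral_diff scaleR_diff_right)
    \<comment> \<open>By linearity the norm bound applies to the difference. Its norm must be finite
      here, as \<open>enn2real\<close> sends \<open>top\<close> to 0.\<close>
    then show "enn2real (c0_norm (\<lambda>n. haar_transform \<alpha> F n - haar_transform \<alpha> G n))
        \<le> 1 * enn2real (holder_norm \<alpha> (\<lambda>t. F t - G t))"
      using enn2real_mono[OF c0_norm_haar_transform_le holder_norm_diff_finite[OF FG assms]]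
      by (simp only: mult_1)
  qed (auto intro: haar_transform_in_c0_space)
qed

subsection \<open>Membership in the Hoelder space\<close>

lemma holder0_spaceI:
  fixes F :: "real \<Rightarrow> 'a::real_normed_vector"
  assumes "\<And>t. t \<notin> {0..1} \<Longrightarrow> F t = 0" "F 0 = 0"
    and incr: "\<And>\<epsilon>. 0 < \<epsilon> \<Longrightarrow> \<exists>\<delta>>0. \<forall>s\<in>{0..1}. \<forall>t\<in>{0..1}. \<bar>t - s\<bar> < \<delta> \<longrightarrow>
      norm (F t - F s) \<le> \<epsilon> * \<bar>t - s\<bar> powr \<alpha>"
  shows "F \<in> holder0_space \<alpha>"
proof -
  let ?S = "\<lambda>\<delta>. SUP (s, t) \<in> {(s, t). s \<in> {0..1} \<and> t \<in> {0..1} \<and> t \<noteq> s \<and> \<bar>t - s\<bar> < \<delta>}.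
    ennreal (norm (F t - F s) / \<bar>t - s\<bar> powr \<alpha>)"
  have "(?S \<longlongrightarrow> 0) (at_right 0)"
  proof (rule order_tendstoI)
    fix a :: ennreal
    assume "0 < a"
    \<comment> \<open>The supremum will only be bounded by \<open>\<le>\<close>, so some room below
      \<open>a\<close> is needed; moreover \<open>b\<close> is finite even if
      \<open>a = top\<close>.\<close>
    then obtain b where b: "0 < b" "b < a"
      using dense by blast
    define \<epsilon> where "\<epsilon> = enn2real b"
    have \<epsilon>: "b = ennreal \<epsilon>" "0 < \<epsilon>"
      using b by (auto simp: \<epsilon>_def enn2real_positive_iff ennreal_enn2real_if order.strict_trans2[OF b(2) top_greatest])
    obtain \<delta> where \<delta>: "\<delta> > 0" "\<And>s t. s \<in> {0..1} \<Longrightarrow> t \<in> {0..1} \<Longrightarrow> \<bar>t - s\<bar> < \<delta>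
        \<Longrightarrow> norm (F t - F s) \<le> \<epsilon> * \<bar>t - s\<bar> powr \<alpha>"
      using incr[OF \<epsilon>(2)] by blast
    have "?S d \<le> b" if "d < \<delta>" for d
    proof (rule SUP_least, clarify)
      fix s t :: real
      assume st: "s \<in> {0..1}" "t \<in> {0..1}" "t \<noteq> s" "\<bar>t - s\<bar> < d"
      then have "norm (F t - F s) / \<bar>t - s\<bar> powr \<alpha> \<le> \<epsilon>"
        using \<delta>(2)[of s t] that by (simp add: pos_divide_le_eq)
      then show "ennreal (norm (F t - F s) / \<bar>t - s\<bar> powr \<alpha>) \<le> b"
        unfolding \<epsilon> by (rule ennreal_leI)
    qed
    with \<delta>(1) b(2) show "\<forall>\<^sub>F d in at_right 0. ?S d < a"
      unfolding eventually_at_right_field by (blast intro: order_le_less_trans)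
  qed simp
  with assms(1,2) show ?thesis
    by (simp add: holder0_space_def)
qed

lemma Lipschitz_in_holder0_space:
  fixes F :: "real \<Rightarrow> 'a::real_normed_vector"
  assumes \<alpha>: "\<alpha> < 1" and F: "\<And>t. t \<notin> {0..1} \<Longrightarrow> F t = 0" "F 0 = 0"
    and L: "\<And>s t. s \<in> {0..1} \<Longrightarrow> t \<in> {0..1} \<Longrightarrow> norm (F t - F s) \<le> L * \<bar>t - s\<bar>"
  shows "F \<in> holder0_space \<alpha>"
proof (rule holder0_spaceI)
  fix \<epsilon> :: real
  assume \<epsilon>: "0 < \<epsilon>"
  \<comment> \<open>The maximum with 1 makes the divisor positive, and \<open>\<delta>\<close>
    solves \<open>L' * \<delta> powr (1 - \<alpha>) = \<epsilon>\<close>.\<close>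
  define L' where "L' = max L 1"
  define \<delta> where "\<delta> = (\<epsilon> / L') powr (1 / (1 - \<alpha>))"
  have L': "0 < L'"
    by (simp add: L'_def)
  have "norm (F t - F s) \<le> \<epsilon> * \<bar>t - s\<bar> powr \<alpha>"
    if st: "s \<in> {0..1}" "t \<in> {0..1}" "\<bar>t - s\<bar> < \<delta>" for s t
  proof (cases "s = t")
    case False
    have "norm (F t - F s) \<le> L * \<bar>t - s\<bar>"
      using st by (intro L)
    also have "\<dots> \<le> L' * \<bar>t - s\<bar>"
      by (intro mult_right_mono) (simp_all add: L'_def)
    also have "\<bar>t - s\<bar> = \<bar>t - s\<bar> powr (1 - \<alpha>) * \<bar>t - s\<bar> powr \<alpha>"
      using False by (simp flip: powr_add)
    also have "L' * (\<bar>t - s\<bar> powr (1 - \<alpha>) * \<bar>t - s\<bar> powr \<alpha>)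
        \<le> L' * (\<delta> powr (1 - \<alpha>) * \<bar>t - s\<bar> powr \<alpha>)"
      using st \<alpha> L' by (intro mult_left_mono mult_right_mono powr_mono2) auto
    also have "\<delta> powr (1 - \<alpha>) = \<epsilon> / L'"
      using \<alpha> \<epsilon> L' by (simp add: \<delta>_def powr_powr)
    finally show ?thesis
      using L' by simp
  qed simp
  moreover have "0 < \<delta>"
    using \<epsilon> L' by (simp add: \<delta>_def)
  ultimately show "\<exists>\<delta>>0. \<forall>s\<in>{0..1}. \<forall>t\<in>{0..1}. \<bar>t - s\<bar> < \<delta> \<longrightarrow>
      norm (F t - F s) \<le> \<epsilon> * \<bar>t - s\<bar> powr \<alpha>"
    by blast
qed (use F in auto)

subsection \<open>Convergence of the Schauder series\<close>

text \<open>One increment is dominated by the sum over its level, and the linear branch of the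
  minimum gives the constant. It may depend on \<open>n\<close>, which is harmless in finite partial
  sums.\<close>

lemma hat_Lipschitz:
  "\<exists>L. \<forall>s\<in>{0..1}. \<forall>t\<in>{0..1}. \<bar>hat \<alpha> n t - hat \<alpha> n s\<bar> \<le> L * \<bar>t - s\<bar>"
proof (cases n rule: dyadic_cases)
  case 0
  then show ?thesis
    by (intro exI[of _ 1]) (simp add: hat_0)
next
  case (dyadic k l)
  have "\<bar>hat \<alpha> n t - hat \<alpha> n s\<bar> \<le> (2 powr - \<alpha>) ^ (k + 1) * 2 ^ (k + 1) * \<bar>t - s\<bar>"
    if "s \<in> {0..1}" "t \<in> {0..1}" for s t
  proof -
    have "\<bar>hat \<alpha> n t - hat \<alpha> n s\<bar> \<le> (\<Sum>l<2 ^ k. \<bar>hat \<alpha> (2 ^ k + l) t - hat \<alpha> (2 ^ k + l) s\<bar>)"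
      unfolding dyadic(2)
      by (rule member_le_sum[of l _ "\<lambda>l. \<bar>hat \<alpha> (2 ^ k + l) t - hat \<alpha> (2 ^ k + l) s\<bar>"])
        (use dyadic(1) in auto)
    also have "\<dots> \<le> (2 powr - \<alpha>) ^ (k + 1) * min 2 (2 ^ (k + 1) * \<bar>t - s\<bar>)"
      using that by (intro sum_hat_diff_level_le) auto
    also have "\<dots> \<le> (2 powr - \<alpha>) ^ (k + 1) * (2 ^ (k + 1) * \<bar>t - s\<bar>)"
      by (intro mult_left_mono) auto
    finally show ?thesis
      by (simp only: mult.assoc)
  qed
  then show ?thesis
    by blast
qed

lemma schauder_term:
  fixes v :: "'a::real_vector"
  shows "schauder n t *\<^sub>R (v /\<^sub>R haar_weight \<alpha> n) = hat \<alpha> n t *\<^sub>R v"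
  by (simp add: hat_def divide_inverse)

lemma schauder_partial_sum_in_holder0_space:
  assumes "\<alpha> < 1"
  shows "schauder_partial_sum \<alpha> (\<eta> :: nat \<Rightarrow> 'a::real_normed_vector) N \<in> holder0_space \<alpha>"
proof -
  obtain L where L: "\<And>n s t. s \<in> {0..1} \<Longrightarrow> t \<in> {0..1} \<Longrightarrow> \<bar>hat \<alpha> n t - hat \<alpha> n s\<bar> \<le> L n * \<bar>t - s\<bar>"
    using hat_Lipschitz[of \<alpha>] by metis
  show ?thesis
  proof (rule Lipschitz_in_holder0_space[OF assms])
    fix s t :: real
    assume st: "s \<in> {0..1}" "t \<in> {0..1}"
    then have "norm (schauder_partial_sum \<alpha> \<eta> N t - schauder_partial_sum \<alpha> \<eta> N s)
        = norm (\<Sum>n<N. (hat \<alpha> n t - hat \<alpha> n s) *\<^sub>R \<eta> n)"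
      by (simp only: schauder_partial_sum_def schauder_term if_True scaleR_diff_left sum_subtractf)
    also have "\<dots> \<le> (\<Sum>n<N. norm ((hat \<alpha> n t - hat \<alpha> n s) *\<^sub>R \<eta> n))"
      by (rule norm_sum)
    also have "\<dots> \<le> (\<Sum>n<N. L n * \<bar>t - s\<bar> * norm (\<eta> n))"
      using L[OF st] by (intro sum_mono) (simp add: mult_right_mono)
    also have "\<dots> = (\<Sum>n<N. L n * norm (\<eta> n)) * \<bar>t - s\<bar>"
      unfolding sum_distrib_right by (simp add: ac_simps)
    finally show "norm (schauder_partial_sum \<alpha> \<eta> N t - schauder_partial_sum \<alpha> \<eta> N s)
        \<le> (\<Sum>n<N. L n * norm (\<eta> n)) * \<bar>t - s\<bar>" .
  qed (simp_all add: schauder_partial_sum_def schauder_at_0 del: atLeastAtMost_iff)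
qed

lemma schauder_bound_pos: "0 < \<alpha> \<Longrightarrow> \<alpha> < 1 \<Longrightarrow> 0 < schauder_bound \<alpha>"
  by (simp add: schauder_bound_def)

text \<open>Only the terms from \<open>N\<close> to \<open>M\<close> remain, with coefficients of
  norm at most \<open>\<epsilon>\<close>. Extending the sum of absolute increments to all indices
  below \<open>M\<close> makes the uniform bound applicable.\<close>

lemma schauder_partial_sum_increment_le:
  fixes \<eta> :: "nat \<Rightarrow> 'a::real_normed_vector"
  assumes \<alpha>: "0 < \<alpha>" "\<alpha> < 1" and st: "s \<in> {0..1}" "t \<in> {0..1}"
    and \<eta>: "\<And>n. N \<le> n \<Longrightarrow> norm (\<eta> n) \<le> \<epsilon>" and "N \<le> M"
  shows "norm ((schauder_partial_sum \<alpha> \<eta> M t - schauder_partial_sum \<alpha> \<eta> N t)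
      - (schauder_partial_sum \<alpha> \<eta> M s - schauder_partial_sum \<alpha> \<eta> N s))
    \<le> \<epsilon> * (schauder_bound \<alpha> * \<bar>t - s\<bar> powr \<alpha>)"
proof -
  have \<epsilon>: "0 \<le> \<epsilon>"
    using \<eta>[of N] norm_ge_zero[of "\<eta> N"] by linarith
  have diff: "schauder_partial_sum \<alpha> \<eta> M u - schauder_partial_sum \<alpha> \<eta> N u
      = (\<Sum>n\<in>{N..<M}. hat \<alpha> n u *\<^sub>R \<eta> n)" if "u \<in> {0..1}" for u
    using that \<open>N \<le> M\<close> sum_diff_nat_ivl[of 0 N M "\<lambda>n. hat \<alpha> n u *\<^sub>R \<eta> n"]
    by (simp only: schauder_partial_sum_def schauder_term lessThan_atLeast0 if_True)
  have "norm ((schauder_partial_sum \<alpha> \<eta> M t - schauder_partial_sum \<alpha> \<eta> N t)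
      - (schauder_partial_sum \<alpha> \<eta> M s - schauder_partial_sum \<alpha> \<eta> N s))
      = norm (\<Sum>n\<in>{N..<M}. (hat \<alpha> n t - hat \<alpha> n s) *\<^sub>R \<eta> n)"
    by (simp only: diff st scaleR_diff_left sum_subtractf)
  also have "\<dots> \<le> (\<Sum>n\<in>{N..<M}. norm ((hat \<alpha> n t - hat \<alpha> n s) *\<^sub>R \<eta> n))"
    by (rule norm_sum)
  also have "\<dots> \<le> (\<Sum>n\<in>{N..<M}. \<epsilon> * \<bar>hat \<alpha> n t - hat \<alpha> n s\<bar>)"
    using \<eta> by (intro sum_mono) (simp add: mult_left_mono mult.commute[of \<epsilon>])
  also have "\<dots> \<le> (\<Sum>n<M. \<epsilon> * \<bar>hat \<alpha> n t - hat \<alpha> n s\<bar>)"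
    using \<epsilon> by (intro sum_mono2) auto
  also have "\<dots> \<le> \<epsilon> * (schauder_bound \<alpha> * \<bar>t - s\<bar> powr \<alpha>)"
    unfolding sum_distrib_left[symmetric] by (intro mult_left_mono sum_hat_diff_le \<alpha> st \<epsilon>)
  finally show ?thesis .
qed

lemma c0_space_tail:
  assumes "\<eta> \<in> c0_space" "0 < \<epsilon>"
  obtains N where "\<And>n. N \<le> n \<Longrightarrow> norm (\<eta> n) \<le> \<epsilon>"
proof -
  have "(\<lambda>n. norm (\<eta> n)) \<longlonglongrightarrow> 0"
    using assms(1) by (simp add: c0_space_def)
  then obtain N where "\<forall>n\<ge>N. norm (norm (\<eta> n) - 0) < \<epsilon>"
    using LIMSEQ_D[OF _ assms(2)] by blast
  then show ?thesis
    by (intro that[of N]) (simp add: less_imp_le)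
qed

text \<open>The Cauchy criterion is checked by hand because the library states it for sort \<open>banach\<close>,
  which is not implied by the two classes here.\<close>

lemma schauder_partial_sum_LIMSEQ:
  fixes \<eta> :: "nat \<Rightarrow> 'a::{real_normed_vector, complete_space}"
  assumes \<alpha>: "0 < \<alpha>" "\<alpha> < 1" and \<eta>: "\<eta> \<in> c0_space"
  shows "(\<lambda>N. schauder_partial_sum \<alpha> \<eta> N t) \<longlonglongrightarrow> schauder_series \<alpha> \<eta> t"
proof (cases "t \<in> {0..1}")
  case t: True
  define S where "S N = schauder_partial_sum \<alpha> \<eta> N t" for N
  have S: "S N = (\<Sum>n<N. schauder n t *\<^sub>R (\<eta> n /\<^sub>R haar_weight \<alpha> n))" for N
    by (simp only: S_def schauder_partial_sum_def t if_True)
  \<comment> \<open>As partial sums vanish at 0, the increment bound with \<open>s = 0\<close>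
    becomes a bound on values.\<close>
  have S0: "schauder_partial_sum \<alpha> \<eta> N 0 = 0" for N
    by (simp add: schauder_partial_sum_def schauder_at_0)
  have "Cauchy S"
  proof (rule CauchyI)
    fix e :: real
    assume "0 < e"
    define C where "C = schauder_bound \<alpha>"
    have C: "0 < C"
      using schauder_bound_pos[OF \<alpha>] by (simp add: C_def)
    \<comment> \<open>Two terms beyond \<open>N\<close> each differ from \<open>S N\<close> by at
      most \<open>e / 3\<close>, which leaves a strict inequality for their distance.\<close>
    define \<epsilon> where "\<epsilon> = e / (3 * C)"
    have "0 < \<epsilon>"
      using \<open>0 < e\<close> C by (simp add: \<epsilon>_def)
    then obtain N where N: "\<And>n. N \<le> n \<Longrightarrow> norm (\<eta> n) \<le> \<epsilon>"
      using c0_space_tail[OF \<eta>] by blast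
    have *: "norm (S M - S N) \<le> e / 3" if "N \<le> M" for M
    proof -
      have "norm (S M - S N) \<le> \<epsilon> * (C * \<bar>t - 0\<bar> powr \<alpha>)"
        using schauder_partial_sum_increment_le[where \<eta> = \<eta>, OF \<alpha> _ t N that, of 0] by (simp add: S_def C_def S0)
      also have "\<dots> \<le> \<epsilon> * (C * 1)"
        using t \<alpha> C \<open>0 < \<epsilon>\<close> by (intro mult_left_mono powr_le1) auto
      also have "\<dots> = e / 3"
        using C by (simp add: \<epsilon>_def)
      finally show ?thesis .
    qed
    have "norm (S m - S n) < e" if "N \<le> m" "N \<le> n" for m n
      using norm_triangle_ineq4[of "S m - S N" "S n - S N"] *[OF that(1)] *[OF that(2)] \<open>0 < e\<close>
      by simp
    then show "\<exists>M. \<forall>m\<ge>M. \<forall>n\<ge>M. norm (S m - S n) < e"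
      by blast
  qed
  then have "convergent S"
    by (simp add: Cauchy_convergent_iff)
  then have "summable (\<lambda>n. schauder n t *\<^sub>R (\<eta> n /\<^sub>R haar_weight \<alpha> n))"
    unfolding summable_iff_convergent S .
  then show ?thesis
    using t summable_LIMSEQ by (simp only: schauder_partial_sum_def schauder_series_def if_True)
qed (simp add: schauder_partial_sum_def schauder_series_def del: atLeastAtMost_iff)

text \<open>The bound for partial sums is free of \<open>M\<close> and therefore survives the
  pointwise limit in \<open>M\<close>.\<close>

lemma schauder_series_increment_le:
  fixes \<eta> :: "nat \<Rightarrow> 'a::{real_normed_vector, complete_space}"
  assumes \<alpha>: "0 < \<alpha>" "\<alpha> < 1" and "\<eta> \<in> c0_space" and st: "s \<in> {0..1}" "t \<in> {0..1}"
    and \<eta>: "\<And>n. N \<le> n \<Longrightarrow> norm (\<eta> n) \<le> \<epsilon>"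
  shows "norm ((schauder_series \<alpha> \<eta> t - schauder_partial_sum \<alpha> \<eta> N t)
      - (schauder_series \<alpha> \<eta> s - schauder_partial_sum \<alpha> \<eta> N s))
    \<le> \<epsilon> * (schauder_bound \<alpha> * \<bar>t - s\<bar> powr \<alpha>)"
proof (rule LIMSEQ_le_const2)
  show "(\<lambda>M. norm ((schauder_partial_sum \<alpha> \<eta> M t - schauder_partial_sum \<alpha> \<eta> N t)
      - (schauder_partial_sum \<alpha> \<eta> M s - schauder_partial_sum \<alpha> \<eta> N s)))
    \<longlonglongrightarrow> norm ((schauder_series \<alpha> \<eta> t - schauder_partial_sum \<alpha> \<eta> N t)
      - (schauder_series \<alpha> \<eta> s - schauder_partial_sum \<alpha> \<eta> N s))"
    by (intro tendsto_intros schauder_partial_sum_LIMSEQ assms)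
qed (use schauder_partial_sum_increment_le[where \<eta> = \<eta>, OF \<alpha> st \<eta>] in blast)

text \<open>With \<open>N = 0\<close> this bounds the norm of the inverse; with large
  \<open>N\<close> it gives convergence in the Hoelder norm.\<close>

lemma holder_norm_tail_le:
  fixes \<eta> :: "nat \<Rightarrow> 'a::{real_normed_vector, complete_space}"
  assumes \<alpha>: "0 < \<alpha>" "\<alpha> < 1" and "\<eta> \<in> c0_space" and \<eta>: "\<And>n. N \<le> n \<Longrightarrow> norm (\<eta> n) \<le> \<epsilon>"
  shows "holder_norm \<alpha> (\<lambda>t. schauder_series \<alpha> \<eta> t - schauder_partial_sum \<alpha> \<eta> N t)
    \<le> ennreal (\<epsilon> * schauder_bound \<alpha>)"
  unfolding holder_norm_le_iff
proof (intro allI impI ennreal_leI)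
  fix s t :: real
  assume "0 \<le> s \<and> s < t \<and> t \<le> 1"
  then show "norm ((schauder_series \<alpha> \<eta> t - schauder_partial_sum \<alpha> \<eta> N t)
      - (schauder_series \<alpha> \<eta> s - schauder_partial_sum \<alpha> \<eta> N s)) / \<bar>t - s\<bar> powr \<alpha>
    \<le> \<epsilon> * schauder_bound \<alpha>"
    using schauder_series_increment_le[where \<eta> = \<eta>, OF assms(1-3) _ _ \<eta>, of s t]
    by (simp add: pos_divide_le_eq mult.assoc)
qed

text \<open>A partial sum is split off. The tail contributes at most \<open>\<epsilon> / 2\<close>
  to the Hoelder quotient at every distance, the partial sum at most \<open>\<epsilon> / 2\<close>
  at small distances.\<close>

lemma schauder_series_in_holder0_space:
  fixes \<eta> :: "nat \<Rightarrow> 'a::{real_normed_vector, complete_space}"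
  assumes \<alpha>: "0 < \<alpha>" "\<alpha> < 1" and \<eta>: "\<eta> \<in> c0_space"
  shows "schauder_series \<alpha> \<eta> \<in> holder0_space \<alpha>"
proof (rule holder0_spaceI)
  let ?G = "schauder_series \<alpha> \<eta>" and ?S = "schauder_partial_sum \<alpha> \<eta>"
  fix \<epsilon> :: real
  assume "0 < \<epsilon>"
  define C where "C = schauder_bound \<alpha>"
  have C: "0 < C"
    using schauder_bound_pos[OF \<alpha>] by (simp add: C_def)
  then have "0 < \<epsilon> / (2 * C)"
    using \<open>0 < \<epsilon>\<close> by simp
  then obtain N where N: "\<And>n. N \<le> n \<Longrightarrow> norm (\<eta> n) \<le> \<epsilon> / (2 * C)"
    using c0_space_tail[OF \<eta>] by blast
  obtain \<delta> where \<delta>: "\<delta> > 0" "\<And>s t. s \<in> {0..1} \<Longrightarrow> t \<in> {0..1} \<Longrightarrow> \<bar>t - s\<bar> < \<delta>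
      \<Longrightarrow> norm (?S N t - ?S N s) \<le> \<epsilon> / 2 * \<bar>t - s\<bar> powr \<alpha>"
    using holder0_space_small_increments[OF schauder_partial_sum_in_holder0_space[OF \<alpha>(2)], of "\<epsilon> / 2"]
      \<open>0 < \<epsilon>\<close> by (metis half_gt_zero)
  have "norm (?G t - ?G s) \<le> \<epsilon> * \<bar>t - s\<bar> powr \<alpha>"
    if st: "s \<in> {0..1}" "t \<in> {0..1}" "\<bar>t - s\<bar> < \<delta>" for s t
  proof -
    have "norm (?G t - ?G s) \<le> norm ((?G t - ?S N t) - (?G s - ?S N s)) + norm (?S N t - ?S N s)"
      using norm_triangle_ineq[of "(?G t - ?S N t) - (?G s - ?S N s)" "?S N t - ?S N s"]
      by (simp add: algebra_simps)
    also have "\<dots> \<le> \<epsilon> / (2 * C) * (C * \<bar>t - s\<bar> powr \<alpha>) + \<epsilon> / 2 * \<bar>t - s\<bar> powr \<alpha>"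
      unfolding C_def using st N
      by (intro add_mono schauder_series_increment_le \<alpha> \<eta> \<delta>(2)) (auto simp: C_def)
    also have "\<dots> = \<epsilon> * \<bar>t - s\<bar> powr \<alpha>"
      using C by (simp add: field_simps)
    finally show ?thesis .
  qed
  with \<delta>(1) show "\<exists>\<delta>>0. \<forall>s\<in>{0..1}. \<forall>t\<in>{0..1}. \<bar>t - s\<bar> < \<delta> \<longrightarrow>
      norm (?G t - ?G s) \<le> \<epsilon> * \<bar>t - s\<bar> powr \<alpha>"
    by blast
qed (simp_all add: schauder_series_def schauder_at_0 del: atLeastAtMost_iff)

lemma limitin_schauder_partial_sum:
  fixes \<eta> :: "nat \<Rightarrow> 'a::{real_normed_vector, complete_space}"
  assumes \<alpha>: "0 < \<alpha>" "\<alpha> < 1" and \<eta>: "\<eta> \<in> c0_space"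
  shows "limitin (mtopology_of (holder0_metric \<alpha>)) (schauder_partial_sum \<alpha> \<eta>)
    (schauder_series \<alpha> \<eta>) sequentially"
proof -
  interpret M: Metric_space "holder0_space \<alpha> :: (real \<Rightarrow> 'a) set"
    "\<lambda>F G. enn2real (holder_norm \<alpha> (\<lambda>t. F t - G t))"
    by (rule Metric_space_holder0[OF \<alpha>(1)])
  have "\<exists>N. \<forall>n\<ge>N. schauder_partial_sum \<alpha> \<eta> n \<in> holder0_space \<alpha> \<and>
      enn2real (holder_norm \<alpha> (\<lambda>t. schauder_partial_sum \<alpha> \<eta> n t - schauder_series \<alpha> \<eta> t)) < \<epsilon>"
    if "0 < \<epsilon>" for \<epsilon>
  proof -
    define C where "C = schauder_bound \<alpha>"
    have C: "0 < C"
      using schauder_bound_pos[OF \<alpha>] by (simp add: C_def)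
    then have pos: "0 < \<epsilon> / (2 * C)"
      using that by simp
    then obtain N where N: "\<And>n. N \<le> n \<Longrightarrow> norm (\<eta> n) \<le> \<epsilon> / (2 * C)"
      using c0_space_tail[OF \<eta>] by blast
    have "enn2real (holder_norm \<alpha> (\<lambda>t. schauder_partial_sum \<alpha> \<eta> n t - schauder_series \<alpha> \<eta> t)) < \<epsilon>"
      if "N \<le> n" for n
    proof -
      have "holder_norm \<alpha> (\<lambda>t. schauder_partial_sum \<alpha> \<eta> n t - schauder_series \<alpha> \<eta> t)
          \<le> ennreal (\<epsilon> / (2 * C) * schauder_bound \<alpha>)"
        unfolding holder_norm_minus[of \<alpha> "schauder_partial_sum \<alpha> \<eta> n"]
        using N that by (intro holder_norm_tail_le \<alpha> \<eta>) auto
      also have "\<epsilon> / (2 * C) * schauder_bound \<alpha> = \<epsilon> / 2"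
        using C by (simp add: C_def)
      finally have "enn2real (holder_norm \<alpha> (\<lambda>t. schauder_partial_sum \<alpha> \<eta> n t - schauder_series \<alpha> \<eta> t))
          \<le> \<epsilon> / 2"
        using \<open>0 < \<epsilon>\<close> by (intro enn2real_leI) auto
      then show ?thesis
        using \<open>0 < \<epsilon>\<close> by simp
    qed
    then show ?thesis
      using schauder_partial_sum_in_holder0_space[OF \<alpha>(2)] by blast
  qed
  then have "limitin M.mtopology (schauder_partial_sum \<alpha> \<eta>) (schauder_series \<alpha> \<eta>) sequentially"
    unfolding M.limit_metric_sequentially using schauder_series_in_holder0_space[OF assms] by blast
  then show ?thesis
    by (simp only: holder0_metric_def M.mtopology_of)
qed

subsection \<open>The transform is an isomorphism\<close>

text \<open>Haar integration acts termwise and the weights cancel. This yields surjectivity and,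
  with injectivity, the formula for the inverse.\<close>

lemma haar_transform_schauder_series:
  fixes \<eta> :: "nat \<Rightarrow> 'a::{real_normed_vector, complete_space}"
  assumes "0 < \<alpha>" "\<alpha> < 1" "\<eta> \<in> c0_space"
  shows "haar_transform \<alpha> (schauder_series \<alpha> \<eta>) = \<eta>"
proof
  fix n
  have "(\<lambda>N. \<Sum>i<N. schauder i t *\<^sub>R (\<eta> i /\<^sub>R haar_weight \<alpha> i)) \<longlonglongrightarrow> schauder_series \<alpha> \<eta> t"
    if "t \<in> {0..1}" for t
    using schauder_partial_sum_LIMSEQ[OF assms, of t] that
    by (simp only: schauder_partial_sum_def if_True)
  then have "haar_integral n (schauder_series \<alpha> \<eta>) = \<eta> n /\<^sub>R haar_weight \<alpha> n"
    by (rule haar_integral_series)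
  then show "haar_transform \<alpha> (schauder_series \<alpha> \<eta>) n = \<eta> n"
    using haar_weight_pos[of \<alpha> n] by (simp add: haar_transform_def)
qed

lemma inj_on_haar_transform:
  assumes "0 < \<alpha>"
  shows "inj_on (haar_transform \<alpha>) (holder0_space \<alpha> :: (real \<Rightarrow> 'a::real_normed_vector) set)"
proof (rule inj_onI)
  fix F G :: "real \<Rightarrow> 'a"
  assume FG: "F \<in> holder0_space \<alpha>" "G \<in> holder0_space \<alpha>"
    and eq: "haar_transform \<alpha> F = haar_transform \<alpha> G"
  have "haar_integral n F = haar_integral n G" for n
    using fun_cong[OF eq, of n] haar_weight_pos[of \<alpha> n] by (simp add: haar_transform_def)
  then have diff: "haar_integral n (\<lambda>t. F t - G t) = 0" for n
    by (simp only: haar_integral_diff diff_self)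
  have cont: "continuous_on {0..1} (\<lambda>t. F t - G t)"
    using FG assms by (intro continuous_on_diff holder0_space_continuous_on)
  have zero: "F 0 - G 0 = 0" "\<And>t. t \<notin> {0..1} \<Longrightarrow> F t - G t = 0"
    using FG by (simp_all add: holder0_space_def)
  show "F = G"
  proof
    fix t
    have "F t - G t = 0"
      using haar_integrals_eq_0_imp_eq_0[OF cont zero(1) diff] zero(2) by (cases "t \<in> {0..1}")
    then show "F t = G t"
      by simp
  qed
qed

lemma bij_betw_haar_transform:
  assumes "0 < \<alpha>" "\<alpha> < 1"
  shows "bij_betw (haar_transform \<alpha>)
    (holder0_space \<alpha> :: (real \<Rightarrow> 'a::{real_normed_vector, complete_space}) set) c0_space"
proof (rule bij_betw_imageI[OF inj_on_haar_transform[OF assms(1)]])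
  show "haar_transform \<alpha> ` (holder0_space \<alpha> :: (real \<Rightarrow> 'a) set) = c0_space"
  proof (intro equalityI subsetI)
    fix \<eta> :: "nat \<Rightarrow> 'a"
    assume "\<eta> \<in> c0_space"
    then show "\<eta> \<in> haar_transform \<alpha> ` holder0_space \<alpha>"
      by (intro image_eqI[of _ _ "schauder_series \<alpha> \<eta>"])
        (simp_all add: haar_transform_schauder_series schauder_series_in_holder0_space assms)
  qed (auto intro: haar_transform_in_c0_space)
qed

lemma inv_into_haar_transform:
  fixes \<eta> :: "nat \<Rightarrow> 'a::{real_normed_vector, complete_space}"
  assumes "0 < \<alpha>" "\<alpha> < 1" "\<eta> \<in> c0_space"
  shows "inv_into (holder0_space \<alpha>) (haar_transform \<alpha>) \<eta> = schauder_series \<alpha> \<eta>"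
  using assms
  by (intro inv_into_f_eq inj_on_haar_transform schauder_series_in_holder0_space
      haar_transform_schauder_series)

section \<open>Operator norms\<close>

lemma operator_norm_le:
  assumes "\<And>x. x \<in> X \<Longrightarrow> q (T x) \<le> C * p x" and "\<And>x. x \<in> X \<Longrightarrow> p x < top"
  shows "operator_norm X p q T \<le> C"
  unfolding operator_norm_def
proof (rule SUP_least)
  fix x
  assume "x \<in> {x \<in> X. p x \<noteq> 0}"
  then have x: "q (T x) \<le> C * p x" "p x < top" "p x \<noteq> 0"
    using assms by auto
  then have "q (T x) / p x \<le> C * p x / p x"
    by (intro divide_right_mono_ennreal)
  \<comment> \<open>Cancelling \<open>p x\<close> in \<open>ennreal\<close> requires it to be
    nonzero and finite.\<close>
  also have "\<dots> = C"
    using x by (simp add: ennreal_mult_divide_eq)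
  finally show "q (T x) / p x \<le> C" .
qed

text \<open>The norm \<open>1\<close> is attained at \<open>t \<mapsto> t v\<close> with a unit vector \<open>v\<close>.\<close>

lemma operator_norm_haar_transform:
  fixes v :: "'a::real_normed_vector"
  assumes \<alpha>: "0 < \<alpha>" "\<alpha> < 1" and v: "norm v = 1"
  shows "operator_norm (holder0_space \<alpha> :: (real \<Rightarrow> 'a) set) (holder_norm \<alpha>) c0_norm
    (haar_transform \<alpha>) = 1"
proof (rule antisym)
  show "operator_norm (holder0_space \<alpha> :: (real \<Rightarrow> 'a) set) (holder_norm \<alpha>) c0_norm
      (haar_transform \<alpha>) \<le> 1"
    by (rule operator_norm_le) (use \<alpha> in \<open>simp_all add: c0_norm_haar_transform_le holder_norm_finite\<close>)
  define F where "F t = (if t \<in> {0..1} then t *\<^sub>R v else 0)" for t :: real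
  have incr: "norm (F t - F s) = \<bar>t - s\<bar>" if "s \<in> {0..1}" "t \<in> {0..1}" for s t
    using that v by (simp add: F_def flip: scaleR_diff_left)
  have F: "F \<in> holder0_space \<alpha>"
    by (rule Lipschitz_in_holder0_space[OF \<alpha>(2), of _ 1]) (use incr in \<open>auto simp: F_def\<close>)
  have le: "holder_norm \<alpha> F \<le> 1"
    unfolding holder_norm_le_iff
  proof (intro allI impI)
    fix s t :: real
    assume st: "0 \<le> s \<and> s < t \<and> t \<le> 1"
    \<comment> \<open>For a base of at most 1 the larger exponent gives the smaller power.\<close>
    then have "\<bar>t - s\<bar> powr 1 \<le> \<bar>t - s\<bar> powr \<alpha>"
      using \<alpha> by (intro powr_mono') auto
    then show "ennreal (norm (F t - F s) / \<bar>t - s\<bar> powr \<alpha>) \<le> 1"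
      using st incr[of s t] by (simp add: pos_divide_le_eq)
  qed
  \<comment> \<open>The coefficient of index 0 has weight 1 and equals
    \<open>F 1 - F 0 = v\<close>.\<close>
  have ge: "1 \<le> c0_norm (haar_transform \<alpha> F)"
    unfolding c0_norm_def
    by (rule SUP_upper2[of 0]) (simp_all add: haar_transform_def haar_integral_0 haar_weight_def F_def v)
  have "holder_norm \<alpha> F = 1"
    using le order.trans[OF ge c0_norm_haar_transform_le] by (rule antisym)
  moreover have "c0_norm (haar_transform \<alpha> F) = 1"
    using order.trans[OF c0_norm_haar_transform_le le] ge by (rule antisym)
  ultimately show "1 \<le> operator_norm (holder0_space \<alpha> :: (real \<Rightarrow> 'a) set) (holder_norm \<alpha>) c0_norm
      (haar_transform \<alpha>)"
    unfolding operator_norm_def using F by (intro SUP_upper2[of F]) auto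
qed

lemma holder_norm_schauder_series_le:
  fixes \<eta> :: "nat \<Rightarrow> 'a::{real_normed_vector, complete_space}"
  assumes \<alpha>: "0 < \<alpha>" "\<alpha> < 1" and \<eta>: "\<eta> \<in> c0_space"
  shows "holder_norm \<alpha> (schauder_series \<alpha> \<eta>) \<le> ennreal (schauder_bound \<alpha>) * c0_norm \<eta>"
proof -
  define B where "B = enn2real (c0_norm \<eta>)"
  have B: "c0_norm \<eta> = ennreal B" "0 \<le> B"
    using c0_norm_finite[OF \<eta>] by (simp_all add: B_def)
  have "norm (\<eta> n) \<le> B" for n
  proof -
    have "ennreal (norm (\<eta> n)) \<le> ennreal B"
      unfolding B(1)[symmetric] c0_norm_def by (rule SUP_upper) simp
    then show ?thesis
      using B(2) by (simp add: ennreal_le_iff)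
  qed
  \<comment> \<open>The partial sum for \<open>N = 0\<close> is empty, so the tail is the whole
    series.\<close>
  then have "holder_norm \<alpha> (\<lambda>t. schauder_series \<alpha> \<eta> t - schauder_partial_sum \<alpha> \<eta> 0 t)
      \<le> ennreal (B * schauder_bound \<alpha>)"
    by (intro holder_norm_tail_le \<alpha> \<eta>)
  also have "(\<lambda>t. schauder_series \<alpha> \<eta> t - schauder_partial_sum \<alpha> \<eta> 0 t) = schauder_series \<alpha> \<eta>"
    by (simp add: schauder_partial_sum_def fun_eq_iff)
  finally show ?thesis
    using B schauder_bound_pos[OF \<alpha>] by (simp add: ennreal_mult mult.commute)
qed

theorem theorem1:
  fixes e :: "nat \<Rightarrow> 'h::{real_inner, complete_space}" and \<alpha> :: real
  assumes "separable_space (euclidean :: 'h topology)"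
    and "complete_orthonormal_system e"
    and "0 < \<alpha>" and "\<alpha> < 1"
  shows "haar_transform \<alpha> \<in> (holder0_space \<alpha> :: (real \<Rightarrow> 'h) set) \<rightarrow> (c0_space :: (nat \<Rightarrow> 'h) set)
    \<and> continuous_map (mtopology_of (holder0_metric \<alpha> :: (real \<Rightarrow> 'h) metric))
        (mtopology_of (c0_metric :: (nat \<Rightarrow> 'h) metric)) (haar_transform \<alpha>)
    \<and> bij_betw (haar_transform \<alpha>) (holder0_space \<alpha> :: (real \<Rightarrow> 'h) set) (c0_space :: (nat \<Rightarrow> 'h) set)
    \<and> operator_norm (holder0_space \<alpha> :: (real \<Rightarrow> 'h) set) (holder_norm \<alpha>) c0_norm (haar_transform \<alpha>) = 1
    \<and> (\<forall>\<eta> \<in> (c0_space :: (nat \<Rightarrow> 'h) set).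
          limitin (mtopology_of (holder0_metric \<alpha>)) (schauder_partial_sum \<alpha> \<eta>) (schauder_series \<alpha> \<eta>) sequentially
        \<and> inv_into (holder0_space \<alpha>) (haar_transform \<alpha>) \<eta> = schauder_series \<alpha> \<eta>)
    \<and> operator_norm (c0_space :: (nat \<Rightarrow> 'h) set) c0_norm (holder_norm \<alpha>)
          (inv_into (holder0_space \<alpha>) (haar_transform \<alpha>))
        \<le> ennreal (2 / ((2 powr \<alpha> - 1) * (2 powr (1 - \<alpha>) - 1)))"
proof (intro conjI ballI)
  \<comment> \<open>A unit vector is needed: on the zero space the operator norm would be a supremum
    over the empty set, that is 0.\<close>
  have "norm (e 0) = 1"
    using assms(2) by (simp add: complete_orthonormal_system_def norm_eq_1)
  then show "operator_norm (holder0_space \<alpha> :: (real \<Rightarrow> 'h) set) (holder_norm \<alpha>) c0_norm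
      (haar_transform \<alpha>) = 1"
    by (rule operator_norm_haar_transform[OF assms(3,4)])
  show "haar_transform \<alpha> \<in> (holder0_space \<alpha> :: (real \<Rightarrow> 'h) set) \<rightarrow> c0_space"
    using haar_transform_in_c0_space by blast
  show "operator_norm (c0_space :: (nat \<Rightarrow> 'h) set) c0_norm (holder_norm \<alpha>)
      (inv_into (holder0_space \<alpha>) (haar_transform \<alpha>))
    \<le> ennreal (2 / ((2 powr \<alpha> - 1) * (2 powr (1 - \<alpha>) - 1)))"
    unfolding schauder_bound_def[symmetric]
    by (rule operator_norm_le)
      (simp_all add: inv_into_haar_transform holder_norm_schauder_series_le c0_norm_finite assms(3,4))
qed (intro continuous_map_haar_transform bij_betw_haar_transform limitin_schauder_partial_sum
  inv_into_haar_transform assms(3,4); assumption)+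

end
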